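(* Let $F$ be a bivariate distribution function both of whose marginals $F_1,F_2$ are freely max-stable. The following are equivalent: (1) $F$ is bi-free max-stable; (2) $F$ is in its own bi-free max-domain of attraction, i.e. $F\in\mathcal{D}_{\star}(F)$; (3) $F$ is a bi-free extreme value distribution function; (4) there exists a Pickands dependence function $A$ such that $F=C_A(F_1,F_2)$, where $C_A$ is the copula determined by $$C_A(u,v)=\frac{uv}{-1+u+v+(2-u-v)A\left(\frac{1-u}{2-u-v}\right)},\qquad (u,v)\in(0,1)^2 .$$ Moreover, if one of (1)-(4) holds, then the dependence function $A$ in (4) is unique.
   Context: A bivariate distribution function is $F(x_1,x_2)=\mu((-\infty,x_1]\times(-\infty,x_2])$ for a Borel probability measure $\mu$ on $\mathbb{R}^2$; $F_1,F_2$ denote its marginal distribution functions. $c_+=\max\{c,0\}$. Bi-free max-convolution: for bivariate distribution functions $F,G$, $H=F\star G$ is the (unique) bivariate distribution function with marginals $H_j=(F_j+G_j-1)_+$ on $\mathbb{R}$, $j=1,2$, and such that $\frac{H_1H_2}{H}=\frac{F_1F_2}{F}+\frac{G_1G_2}{G}-1$ at each $\mathbf{x}$ where $F(\mathbf{x}),G(\mathbf{x}),H_1(x_1),H_2(x_2)$ are all strictly positive, and $H(\mathbf{x})=0$ at all other $\mathbf{x}$. The operation is well defined, commutative and associative; $F^{\star n}$ is the $n$-fold convolution of $F$ with itself. $F$ is bi-free max-stable if for every $n\in\mathbb{N}$ there are $a_n,c_n>0$ and $b_n,d_n\in\mathbb{R}$ with $F^{\star n}(a_nx_1+b_n,c_nx_2+d_n)=F(x_1,x_2)$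 on $\mathbb{R}^2$. $\mathcal{D}_\star(F)$, the bi-free max-domain of attraction of $F$, is the set of bivariate distribution functions $H$ for which there are $a_n,c_n>0$, $b_n,d_n\in\mathbb{R}$ with $H^{\star n}(a_nx_1+b_n,c_nx_2+d_n)\to F(x_1,x_2)$ weakly as $n\to\infty$ (i.e. at continuity points of $F$). $F$ is a bi-free extreme value distribution function if $\mathcal{D}_\star(F)\neq\emptyset$. A univariate extreme value distribution function is $G(x)=\exp[-(1+\xi\frac{x-m}{\sigma})^{-1/\xi}]$ for $1+\xi(x-m)/\sigma>0$ (extended by $0$ or $1$ elsewhere; for $\xi=0$ it is $\exp[-e^{-(x-m)/\sigma}]$), with $\xi,m\in\mathbb{R}$, $\sigma>0$. A univariate distribution function is freely max-stable if it is of a free extremal type, i.e. equals $(1+\log G)_+$ for some univariate extreme value distribution function $G$ (with $(1+\log 0)_+=0$); equivalently, it is a non-degenerate distribution function $K$ such that for every $n$ there are $a_n>0,b_n\in\mathbb{R}$ with $(nK(a_nx+b_n)-(n-1))_+=K(x)$ for all $x$. A Pickands dependence function is a function $A:[0,1]\to[1/2,1]$ of the form $A(t)=\int_{S_2}\max\{tx,(1-t)y\}\,d\rho(x,y)$, where $\rho$ is a finite positive Borel measure on $S_2=\{(x,y)\in[0,1]^2:x+y=1\}$ with $\int x\,d\rho=\int y\,d\rho=1$ (equivalently, $A$ is convex with $t\vee(1-t)\le A(t)\le1$). The function $C_A$ on $(0,1)^2$ extends continuously to a copula on $[0,1]^2$ (so $C_A(u,0)=C_A(0,v)=0$, $C_A(u,1)=u$,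 $C_A(1,v)=v$), also denoted $C_A$. *)

theory Defs
  imports "HOL-Probability.Probability"
begin

definition bivariate_df :: "(real \<times> real \<Rightarrow> real) \<Rightarrow> bool" where
  "bivariate_df F \<longleftrightarrow> (\<exists>\<mu> :: (real \<times> real) measure. prob_space \<mu> \<and> sets \<mu> = sets borel \<and>
     (\<forall>x1 x2. F (x1, x2) = measure \<mu> ({..x1} \<times> {..x2})))"

definition marginal1 :: "(real \<times> real \<Rightarrow> real) \<Rightarrow> real \<Rightarrow> real" where
  "marginal1 F x1 = Lim at_top (\<lambda>x2. F (x1, x2))"

definition marginal2 :: "(real \<times> real \<Rightarrow> real) \<Rightarrow> real \<Rightarrow> real" where
  "marginal2 F x2 = Lim at_top (\<lambda>x1. F (x1, x2))"

text \<open>The limits above are the distribution functions of the two coordinate projections.\<close>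

lemma marginal_eq_measure:
  fixes \<mu> :: "(real \<times> real) measure"
  assumes "prob_space \<mu>" and sets: "sets \<mu> = sets borel"
    and F: "\<And>x1 x2. F (x1, x2) = measure \<mu> ({..x1} \<times> {..x2})"
  shows "marginal1 F x1 = measure \<mu> ({..x1} \<times> UNIV)"
    and "marginal2 F x2 = measure \<mu> (UNIV \<times> {..x2})"
proof -
  interpret prob_space \<mu> by fact
  have S [simp]: "{..a} \<times> {..b} \<in> sets \<mu>" "{..a} \<times> UNIV \<in> sets \<mu>" "UNIV \<times> {..b} \<in> sets \<mu>"
    for a b :: real
    unfolding sets by (auto intro!: borel_closed closed_Times)
  have U1: "(\<Union>n. {..x1} \<times> {..real n}) = {..x1} \<times> UNIV"
    by (simp add: set_eq_iff real_arch_simple)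
  have U2: "(\<Union>n. {..real n} \<times> {..x2}) = UNIV \<times> {..x2}"
    by (simp add: set_eq_iff real_arch_simple)
  have "(\<lambda>n. measure \<mu> ({..x1} \<times> {..real n})) \<longlonglongrightarrow> measure \<mu> (\<Union>n. {..x1} \<times> {..real n})"
    by (rule finite_Lim_measure_incseq) (auto simp: incseq_def)
  then have "((\<lambda>y. F (x1, y)) \<longlongrightarrow> measure \<mu> ({..x1} \<times> UNIV)) at_top"
    unfolding U1 F by (intro tendsto_at_topI_sequentially_real)
      (auto intro!: monoI finite_measure_mono)
  then show "marginal1 F x1 = measure \<mu> ({..x1} \<times> UNIV)"
    unfolding marginal1_def by (intro tendsto_Lim) auto
  have "(\<lambda>n. measure \<mu> ({..real n} \<times> {..x2})) \<longlonglongrightarrow> measure \<mu> (\<Union>n. {..real n} \<times> {..x2})"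
    by (rule finite_Lim_measure_incseq) (auto simp: incseq_def)
  then have "((\<lambda>y. F (y, x2)) \<longlongrightarrow> measure \<mu> (UNIV \<times> {..x2})) at_top"
    unfolding U2 F by (intro tendsto_at_topI_sequentially_real)
      (auto intro!: monoI finite_measure_mono)
  then show "marginal2 F x2 = measure \<mu> (UNIV \<times> {..x2})"
    unfolding marginal2_def by (intro tendsto_Lim) auto
qed

text \<open>
  The bi-free max-convolution is rendered as a relation: \<open>bifree_max_conv F G H\<close> reads \<open>H = F \<star> G\<close>.
  The relation is functional, see \<open>bifree_max_conv_unique\<close>.
  The quotient \<open>H\<^sub>1 H\<^sub>2 / H\<close> hides no division by zero: since \<open>F \<le> min F\<^sub>1 F\<^sub>2\<close> and likewise for \<open>G\<close>,
  the right-hand side is at least \<open>F\<^sub>1 + G\<^sub>1 - 1 > 0\<close>, so \<open>H \<noteq> 0\<close>.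
\<close>

definition bifree_max_conv ::
    "(real \<times> real \<Rightarrow> real) \<Rightarrow> (real \<times> real \<Rightarrow> real) \<Rightarrow> (real \<times> real \<Rightarrow> real) \<Rightarrow> bool" where
  "bifree_max_conv F G H \<longleftrightarrow>
     bivariate_df F \<and> bivariate_df G \<and> bivariate_df H \<and>
     (\<forall>x1. marginal1 H x1 = max (marginal1 F x1 + marginal1 G x1 - 1) 0) \<and>
     (\<forall>x2. marginal2 H x2 = max (marginal2 F x2 + marginal2 G x2 - 1) 0) \<and>
     (\<forall>x1 x2.
       if F (x1, x2) > 0 \<and> G (x1, x2) > 0 \<and> marginal1 H x1 > 0 \<and> marginal2 H x2 > 0
       then marginal1 H x1 * marginal2 H x2 / H (x1, x2) =
              marginal1 F x1 * marginal2 F x2 / F (x1, x2)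
              + marginal1 G x1 * marginal2 G x2 / G (x1, x2) - 1
       else H (x1, x2) = 0)"

lemma bifree_max_conv_unique:
  assumes H: "bifree_max_conv F G H" and K: "bifree_max_conv F G K"
  shows "H = K"
proof
  fix p :: "real \<times> real"
  obtain x1 x2 where p: "p = (x1, x2)" by force
  have m: "marginal1 H x1 = marginal1 K x1" "marginal2 H x2 = marginal2 K x2"
    using H K by (auto simp: bifree_max_conv_def)
  have eq: "s = t" if "m / s = r" "m / t = r" "m \<noteq> 0" for m r s t :: real
    using that(1)[folded that(2)] that(3) by simp
  show "H p = K p"
  proof (cases "F p > 0 \<and> G p > 0 \<and> marginal1 H x1 > 0 \<and> marginal2 H x2 > 0")
    case True
    let ?r = "marginal1 F x1 * marginal2 F x2 / F p + marginal1 G x1 * marginal2 G x2 / G p - 1"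
    have "marginal1 H x1 * marginal2 H x2 / H p = ?r"
      using H[unfolded bifree_max_conv_def, THEN conjunct2, THEN conjunct2, THEN conjunct2,
        THEN conjunct2, THEN conjunct2, rule_format, of x1 x2] True unfolding p by simp
    moreover have "marginal1 H x1 * marginal2 H x2 / K p = ?r"
      using K[unfolded bifree_max_conv_def, THEN conjunct2, THEN conjunct2, THEN conjunct2,
        THEN conjunct2, THEN conjunct2, rule_format, of x1 x2] True m unfolding p by simp
    ultimately
    show ?thesis by (rule eq) (use True in auto)
  next
    case False
    have "H p = 0"
      using H[unfolded bifree_max_conv_def, THEN conjunct2, THEN conjunct2, THEN conjunct2,
        THEN conjunct2, THEN conjunct2, rule_format, of x1 x2] False unfolding p by argo
    moreover have "K p = 0"
      using K[unfolded bifree_max_conv_def, THEN conjunct2, THEN conjunct2, THEN conjunct2,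
        THEN conjunct2, THEN conjunct2, rule_format, of x1 x2] False[unfolded m] unfolding p by argo
    ultimately show ?thesis by simp
  qed
qed

text \<open>\<open>bifree_max_power F n H\<close> reads \<open>H = F\<^sup>\<star>\<^sup>n\<close>, for \<open>n \<ge> 1\<close>.\<close>

inductive bifree_max_power ::
    "(real \<times> real \<Rightarrow> real) \<Rightarrow> nat \<Rightarrow> (real \<times> real \<Rightarrow> real) \<Rightarrow> bool" for F where
  one: "bivariate_df F \<Longrightarrow> bifree_max_power F 1 F"
| step: "bifree_max_power F n K \<Longrightarrow> bifree_max_conv K F H \<Longrightarrow> bifree_max_power F (Suc n) H"

lemma bifree_max_power_pos: "bifree_max_power F n H \<Longrightarrow> n \<ge> 1"
  by (induction rule: bifree_max_power.induct) auto

lemma bifree_max_power_unique: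
  "bifree_max_power F n H \<Longrightarrow> bifree_max_power F n K \<Longrightarrow> H = K"
proof (induction arbitrary: K rule: bifree_max_power.induct)
  case one
  from one(2) show ?case
    by cases (auto dest: bifree_max_power_pos)
next
  case (step n L H)
  from step.prems show ?case
  proof cases
    case one
    then show ?thesis using bifree_max_power_pos[OF step.hyps(1)] by simp
  next
    case (step L')
    then show ?thesis
      using step.IH \<open>bifree_max_conv L F H\<close> bifree_max_conv_unique by auto
  qed
qed

definition bifree_max_stable :: "(real \<times> real \<Rightarrow> real) \<Rightarrow> bool" where
  "bifree_max_stable F \<longleftrightarrow>
     (\<forall>n\<ge>1. \<exists>K a b c d. bifree_max_power F n K \<and> a > 0 \<and> c > 0 \<and>
        (\<forall>x1 x2. K (a * x1 + b, c * x2 + d) = F (x1, x2)))"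

definition bifree_max_domain :: "(real \<times> real \<Rightarrow> real) \<Rightarrow> (real \<times> real \<Rightarrow> real) set" where
  "bifree_max_domain F =
     {H. bivariate_df H \<and>
        (\<exists>(K :: nat \<Rightarrow> real \<times> real \<Rightarrow> real) a b c d.
           (\<forall>n\<ge>1. bifree_max_power H n (K n) \<and> a n > 0 \<and> c n > 0) \<and>
           (\<forall>x1 x2. isCont F (x1, x2) \<longrightarrow>
              (\<lambda>n. K n (a n * x1 + b n, c n * x2 + d n)) \<longlonglongrightarrow> F (x1, x2)))}"

definition bifree_extreme_value :: "(real \<times> real \<Rightarrow> real) \<Rightarrow> bool" where
  "bifree_extreme_value F \<longleftrightarrow> bifree_max_domain F \<noteq> {}"

text \<open>Outside its support the distribution function is \<open>0\<close> (left of it, \<open>\<xi> > 0\<close>) or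
  \<open>1\<close> (right of it, \<open>\<xi> < 0\<close>).\<close>

definition extreme_value_df :: "real \<Rightarrow> real \<Rightarrow> real \<Rightarrow> real \<Rightarrow> real" where
  "extreme_value_df \<xi> m \<sigma> x =
     (if \<xi> = 0 then exp (- exp (- ((x - m) / \<sigma>)))
      else if 1 + \<xi> * ((x - m) / \<sigma>) > 0 then exp (- ((1 + \<xi> * ((x - m) / \<sigma>)) powr (- 1 / \<xi>)))
      else if \<xi> > 0 then 0 else 1)"

text \<open>The case distinction implements \<open>(1 + log 0)\<^sub>+ = 0\<close>, because \<open>ln 0 = 0\<close> in HOL.\<close>

definition freely_max_stable :: "(real \<Rightarrow> real) \<Rightarrow> bool" where
  "freely_max_stable K \<longleftrightarrow>
     (\<exists>\<xi> m \<sigma>. \<sigma> > 0 \<and>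
        (\<forall>x. K x = (if extreme_value_df \<xi> m \<sigma> x = 0 then 0
                    else max (1 + ln (extreme_value_df \<xi> m \<sigma> x)) 0)))"

definition S2 :: "(real \<times> real) set" where
  "S2 = {(x, y). x \<in> {0..1} \<and> y \<in> {0..1} \<and> x + y = 1}"

text \<open>Functions on \<open>[0,1]\<close> are represented by total functions whose values outside \<open>[0,1]\<close>
  are irrelevant.\<close>

definition pickands :: "(real \<Rightarrow> real) \<Rightarrow> bool" where
  "pickands A \<longleftrightarrow>
     A \<in> {0..1} \<rightarrow> {1/2..1} \<and>
     (\<exists>\<rho> :: (real \<times> real) measure.
        finite_measure \<rho> \<and> sets \<rho> = sets (restrict_space borel S2) \<and>
        (LINT p|\<rho>. fst p) = 1 \<and> (LINT p|\<rho>. snd p) = 1 \<and>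
        (\<forall>t\<in>{0..1}. A t = (LINT p|\<rho>. max (t * fst p) ((1 - t) * snd p))))"

text \<open>The last three branches are the boundary values of the continuous extension to \<open>[0,1]\<^sup>2\<close>.\<close>

definition pickands_copula :: "(real \<Rightarrow> real) \<Rightarrow> real \<Rightarrow> real \<Rightarrow> real" where
  "pickands_copula A u v =
     (if u \<in> {0<..<1} \<and> v \<in> {0<..<1}
      then u * v / (- 1 + u + v + (2 - u - v) * A ((1 - u) / (2 - u - v)))
      else if u = 1 then v
      else if v = 1 then u
      else 0)"

definition has_dependence_function :: "(real \<times> real \<Rightarrow> real) \<Rightarrow> (real \<Rightarrow> real) \<Rightarrow> bool" where
  "has_dependence_function F A \<longleftrightarrow>
     pickands A \<and>
     (\<forall>x1 x2. F (x1, x2) = pickands_copula A (marginal1 F x1) (marginal2 F x2))"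

end

theory Submission
  imports Defs "HOL-Real_Asymp.Real_Asymp"
begin

text \<open>
  Write \<open>p = 1 - F\<^sub>1\<close>, \<open>q = 1 - F\<^sub>2\<close> and \<open>\<Phi> = 1 - F\<^sub>1 F\<^sub>2 / F\<close>. On the set where all functions involved
  are positive, the bi-free max-convolution adds each of \<open>p\<close>, \<open>q\<close> and \<open>\<Phi>\<close>. So \<open>F\<^sup>\<star>\<^sup>n\<close> is obtained by
  multiplying the three by \<open>n\<close>, and for freely max-stable marginals being max-stable means that \<open>\<Phi> = h p q\<close> for a function \<open>h\<close> which
  is homogeneous of degree one. The formula \<open>F = C\<^sub>A(F\<^sub>1, F\<^sub>2)\<close> expresses this, with
  \<open>h p q = (p + q) (1 - A (p / (p + q)))\<close>.

  Suppose first that the formula holds. A freely max-stable marginal satisfies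
  \<open>F\<^sub>1(x) = (1 - n (1 - F\<^sub>1(a\<^sub>n x + b\<^sub>n)))\<^sub>+\<close> (\<open>freely_max_stable_rescale\<close>), and therefore
  \<open>K\<^sub>n(x, y) = F((x - b\<^sub>n) / a\<^sub>n, (y - d\<^sub>n) / c\<^sub>n)\<close> has the marginals of \<open>F\<^sup>\<star>\<^sup>n\<close>. It is a distribution
  function, being the image of \<open>F\<close> under an affine map, and homogeneity of \<open>h\<close> gives it the correct
  quotient; so it is \<open>F\<^sup>\<star>\<^sup>n\<close> (\<open>dependence_function_bifree_max_stable\<close>).

  For the converse let \<open>F\<close> attract \<open>H\<close>. Near the upper end of \<open>H\<close> the quantity \<open>1 - H\<^sub>1 H\<^sub>2 / H\<close> is
  close to the probability \<open>T(x, y)\<close> that both coordinates exceed \<open>x\<close> and \<open>y\<close>, up to terms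
  that still vanish in the limit after multiplication by \<open>n\<close>. Hence \<open>n T(a\<^sub>n x + b\<^sub>n, c\<^sub>n y + d\<^sub>n) \<longlonglongrightarrow> \<Phi>(x, y)\<close>
  (\<open>joint_tail_lim\<close>), and \<open>\<Phi>\<close> inherits from \<open>T\<close> the bounds \<open>0 \<le> \<Phi> \<le> min p q\<close> and the nonnegativity of
  rectangle increments. Comparing the thresholds with index \<open>n\<close> to those with index \<open>\<lfloor>n / s\<rfloor>\<close>
  shows that \<open>\<Phi>\<close> is a homogeneous function of \<open>(p, q)\<close> (\<open>\<Phi>_homogeneous\<close>).

  It remains to see that \<open>A t = 1 - h t (1 - t)\<close> is a Pickands function for every homogeneous \<open>h\<close> with
  nonnegative rectangle increments and \<open>0 \<le> h p q \<le> min p q\<close>. Those two properties force \<open>h\<close> to be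
  concave (\<open>concave_on_ratio\<close>, \<open>superadditive\<close>), so the second differences of \<open>A\<close> are nonnegative.
  They are the weights of discrete measures whose integrals \<open>\<integral> max (t x) ((1 - t) y)\<close> interpolate \<open>A\<close> on
  a grid, and a weak limit of these measures represents \<open>A\<close> (\<open>pickands_A\<close>).

  Uniqueness is read off on the points with \<open>F\<^sub>1 = 1 - t\<close> and \<open>F\<^sub>2 = t\<close>, where
  \<open>C\<^sub>A(1 - t, t) = t (1 - t) / A(t)\<close>.
\<close>

section \<open>Bivariate distribution functions\<close>

lemma bivariate_df_swap:
  assumes "bivariate_df F"
  shows "bivariate_df (\<lambda>(x, y). F (y, x))"
proof -
  obtain \<mu> where \<mu>: "prob_space \<mu>" and sets: "sets \<mu> = sets (borel :: (real \<times> real) measure)"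
    and F: "\<And>x y. F (x, y) = measure \<mu> ({..x} \<times> {..y})"
    using assms by (auto simp: bivariate_df_def)
  have sp: "space \<mu> = UNIV" using sets_eq_imp_space_eq[OF sets] by simp
  have meas: "prod.swap \<in> measurable \<mu> (borel :: (real \<times> real) measure)"
    unfolding measurable_cong_sets[OF sets refl]
    by (intro borel_measurable_continuous_onI continuous_on_swap)
  have "measure (distr \<mu> borel prod.swap) ({..x} \<times> {..y}) = F (y, x)" for x y
  proof -
    have "prod.swap -` ({..x} \<times> {..y}) = {..y} \<times> {..x}" by auto
    then show ?thesis
      by (subst measure_distr[OF meas]) (auto simp: F sp intro!: borel_closed closed_Times)
  qed
  then show ?thesis
    unfolding bivariate_df_def
    by (intro exI[of _ "distr \<mu> borel prod.swap"]) (simp add: prob_space.prob_space_distr[OF \<mu> meas])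
qed

lemma marginal_swap [simp]:
  "marginal1 (\<lambda>(x, y). F (y, x)) = marginal2 F"
  "marginal2 (\<lambda>(x, y). F (y, x)) = marginal1 F"
  by (auto simp: marginal1_def marginal2_def)

lemma bivariate_df_affine:
  assumes "bivariate_df F" "a > 0" "c > 0"
  shows "bivariate_df (\<lambda>(x, y). F (a * x + b, c * y + d))"
proof -
  obtain \<mu> where \<mu>: "prob_space \<mu>" and sets: "sets \<mu> = sets (borel :: (real \<times> real) measure)"
    and F: "\<And>x y. F (x, y) = measure \<mu> ({..x} \<times> {..y})"
    using assms by (auto simp: bivariate_df_def)
  have sp: "space \<mu> = UNIV" using sets_eq_imp_space_eq[OF sets] by simp
  define \<phi> where "\<phi> = (\<lambda>p :: real \<times> real. ((fst p - b) / a, (snd p - d) / c))"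
  have meas: "\<phi> \<in> measurable \<mu> (borel :: (real \<times> real) measure)"
    unfolding measurable_cong_sets[OF sets refl] \<phi>_def
    by (intro borel_measurable_continuous_onI continuous_intros) (use assms in auto)
  have "measure (distr \<mu> borel \<phi>) ({..x} \<times> {..y}) = F (a * x + b, c * y + d)" for x y
  proof -
    have "\<phi> -` ({..x} \<times> {..y}) = {..a * x + b} \<times> {..c * y + d}"
      using assms by (auto simp: \<phi>_def divide_le_eq algebra_simps)
    then show ?thesis
      by (subst measure_distr[OF meas]) (auto simp: F sp intro!: borel_closed closed_Times)
  qed
  then show ?thesis
    unfolding bivariate_df_def
    by (intro exI[of _ "distr \<mu> borel \<phi>"]) (simp add: prob_space.prob_space_distr[OF \<mu> meas])
qed

lemma bivariate_df_nonneg: "bivariate_df F \<Longrightarrow> 0 \<le> F p"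
  unfolding bivariate_df_def by (cases p) auto

lemma bivariate_df_mono:
  assumes "bivariate_df F" "x \<le> x'" "y \<le> y'"
  shows "F (x, y) \<le> F (x', y')"
proof -
  obtain \<mu> where \<mu>: "prob_space \<mu>" and sets: "sets \<mu> = sets (borel :: (real \<times> real) measure)"
    and F: "\<And>x y. F (x, y) = measure \<mu> ({..x} \<times> {..y})"
    using assms by (auto simp: bivariate_df_def)
  interpret prob_space \<mu> by fact
  show ?thesis unfolding F
    by (rule finite_measure_mono) (use assms sets in \<open>auto intro!: borel_closed closed_Times\<close>)
qed

lemma bivariate_df_rectangle:
  assumes "bivariate_df F" "x \<le> x'" "y \<le> y'"
  shows "F (x, y') + F (x', y) \<le> F (x, y) + F (x', y')"
proof -
  obtain \<mu> where \<mu>: "prob_space \<mu>" and sets: "sets \<mu> = sets (borel :: (real \<times> real) measure)"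
    and F: "\<And>x y. F (x, y) = measure \<mu> ({..x} \<times> {..y})"
    using assms by (auto simp: bivariate_df_def)
  interpret prob_space \<mu> by fact
  have S [simp]: "{..s} \<times> {..t} \<in> sets \<mu>" for s t :: real
    unfolding sets by (auto intro!: borel_closed closed_Times)
  have I: "({..x} \<times> {..y'}) \<inter> ({..x'} \<times> {..y}) = {..x} \<times> {..y}" using assms by auto
  have "measure \<mu> ({..x} \<times> {..y'}) + measure \<mu> ({..x'} \<times> {..y}) =
      measure \<mu> ({..x} \<times> {..y'} \<union> {..x'} \<times> {..y}) + measure \<mu> ({..x} \<times> {..y})"
    using measure_Un3[of "{..x} \<times> {..y'}" \<mu> "{..x'} \<times> {..y}"] I by (simp add: fmeasurable_eq_sets)
  also have "measure \<mu> ({..x} \<times> {..y'} \<union> {..x'} \<times> {..y}) \<le> measure \<mu> ({..x'} \<times> {..y'})"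
    by (rule finite_measure_mono) (use assms in auto)
  finally show ?thesis by (simp add: F)
qed

lemma bivariate_df_tendsto_marginal1:
  assumes "bivariate_df F"
  shows "((\<lambda>y. F (x, y)) \<longlongrightarrow> marginal1 F x) at_top"
proof -
  obtain \<mu> where \<mu>: "prob_space \<mu>" and sets: "sets \<mu> = sets (borel :: (real \<times> real) measure)"
    and F: "\<And>x y. F (x, y) = measure \<mu> ({..x} \<times> {..y})"
    using assms by (auto simp: bivariate_df_def)
  interpret prob_space \<mu> by fact
  have S: "{..s} \<times> {..t} \<in> sets \<mu>" for s t :: real
    unfolding sets by (auto intro!: borel_closed closed_Times)
  have U: "(\<Union>n. {..x} \<times> {..real n}) = {..x} \<times> UNIV"
    by (simp add: set_eq_iff real_arch_simple)
  have "(\<lambda>n. measure \<mu> ({..x} \<times> {..real n})) \<longlonglongrightarrow> measure \<mu> (\<Union>n. {..x} \<times> {..real n})"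
    by (rule finite_Lim_measure_incseq) (auto simp: incseq_def S)
  then show ?thesis
    unfolding U marginal_eq_measure(1)[OF \<mu> sets F, symmetric] F[symmetric]
    by (intro tendsto_at_topI_sequentially_real monoI bivariate_df_mono[OF assms]) auto
qed

lemma bivariate_df_tendsto_marginal2:
  assumes "bivariate_df F"
  shows "((\<lambda>x. F (x, y)) \<longlongrightarrow> marginal2 F y) at_top"
  using bivariate_df_tendsto_marginal1[OF bivariate_df_swap[OF assms], of y] by simp

lemma bivariate_df_diagonal_tendsto:
  assumes "bivariate_df F"
  shows "((\<lambda>y. F (y, y)) \<longlongrightarrow> 1) at_top"
proof -
  obtain \<mu> where \<mu>: "prob_space \<mu>" and sets: "sets \<mu> = sets (borel :: (real \<times> real) measure)"
    and F: "\<And>x y. F (x, y) = measure \<mu> ({..x} \<times> {..y})"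
    using assms by (auto simp: bivariate_df_def)
  interpret prob_space \<mu> by fact
  have S: "{..s} \<times> {..t} \<in> sets \<mu>" for s t :: real
    unfolding sets by (auto intro!: borel_closed closed_Times)
  have U: "(\<Union>n. {..real n} \<times> {..real n}) = space \<mu>"
  proof -
    have "\<exists>n. s \<le> real n \<and> t \<le> real n" for s t :: real
      using real_arch_simple[of "max s t"] by auto
    then show ?thesis using sets_eq_imp_space_eq[OF sets] by (simp add: set_eq_iff)
  qed
  have "(\<lambda>n. measure \<mu> ({..real n} \<times> {..real n})) \<longlonglongrightarrow> measure \<mu> (\<Union>n. {..real n} \<times> {..real n})"
    by (rule finite_Lim_measure_incseq) (auto simp: incseq_def S)
  then show ?thesis
    unfolding U prob_space F[symmetric]
    by (intro tendsto_at_topI_sequentially_real monoI bivariate_df_mono[OF assms]) auto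
qed

lemma marginal_affine:
  assumes "bivariate_df F" "a > 0" "c > 0"
  shows "marginal1 (\<lambda>(x, y). F (a * x + b, c * y + d)) x = marginal1 F (a * x + b)"
    and "marginal2 (\<lambda>(x, y). F (a * x + b, c * y + d)) y = marginal2 F (c * y + d)"
proof -
  have lim: "filterlim (\<lambda>z. r * z + s) at_top at_top" if "r > 0" for r s :: real
    using that by real_asymp
  show "marginal1 (\<lambda>(x, y). F (a * x + b, c * y + d)) x = marginal1 F (a * x + b)"
    unfolding marginal1_def[of "\<lambda>(x, y). F (a * x + b, c * y + d)"]
    using filterlim_compose[OF bivariate_df_tendsto_marginal1[OF assms(1)] lim[OF assms(3)]]
    by (intro tendsto_Lim) auto
  show "marginal2 (\<lambda>(x, y). F (a * x + b, c * y + d)) y = marginal2 F (c * y + d)"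
    unfolding marginal2_def[of "\<lambda>(x, y). F (a * x + b, c * y + d)"]
    using filterlim_compose[OF bivariate_df_tendsto_marginal2[OF assms(1)] lim[OF assms(2)]]
    by (intro tendsto_Lim) auto
qed

lemma bivariate_df_le_marginal:
  assumes "bivariate_df F"
  shows "F (x, y) \<le> marginal1 F x" "F (x, y) \<le> marginal2 F y"
proof -
  have *: "G (x, y) \<le> marginal1 G x" if "bivariate_df G" for G x y
    by (rule tendsto_lowerbound[OF bivariate_df_tendsto_marginal1[OF that]])
       (auto simp: eventually_at_top_linorder intro!: exI[of _ y] bivariate_df_mono[OF that])
  show "F (x, y) \<le> marginal1 F x" by (rule *[OF assms])
  show "F (x, y) \<le> marginal2 F y" using *[OF bivariate_df_swap[OF assms], of y x] by simp
qed

lemma bivariate_df_marginal_increment: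
  assumes "bivariate_df F" "x \<le> x'"
  shows "F (x', y) - F (x, y) \<le> marginal1 F x' - marginal1 F x"
  by (rule tendsto_lowerbound[OF tendsto_diff[OF
        bivariate_df_tendsto_marginal1[OF assms(1)] bivariate_df_tendsto_marginal1[OF assms(1)]]])
     (use bivariate_df_rectangle[OF assms, of y] in
       \<open>auto simp: eventually_at_top_linorder algebra_simps intro!: exI[of _ y]\<close>)

lemma bivariate_df_marginal_increment2:
  assumes "bivariate_df F" "y \<le> y'"
  shows "F (x, y') - F (x, y) \<le> marginal2 F y' - marginal2 F y"
  using bivariate_df_marginal_increment[OF bivariate_df_swap[OF assms(1)] assms(2), of x] by simp

lemma bivariate_df_Lipschitz:
  assumes "bivariate_df F"
  shows "\<bar>F (x', y') - F (x, y)\<bar> \<le>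
    \<bar>marginal1 F x' - marginal1 F x\<bar> + \<bar>marginal2 F y' - marginal2 F y\<bar>"
proof -
  have "\<bar>F (x', y') - F (x, y')\<bar> \<le> \<bar>marginal1 F x' - marginal1 F x\<bar>"
    using bivariate_df_marginal_increment[OF assms, of x x' y']
      bivariate_df_marginal_increment[OF assms, of x' x y']
      bivariate_df_mono[OF assms, of x x' y' y'] bivariate_df_mono[OF assms, of x' x y' y']
    by linarith
  moreover have "\<bar>F (x, y') - F (x, y)\<bar> \<le> \<bar>marginal2 F y' - marginal2 F y\<bar>"
    using bivariate_df_marginal_increment2[OF assms, of y y' x]
      bivariate_df_marginal_increment2[OF assms, of y' y x]
      bivariate_df_mono[OF assms, of x x y y'] bivariate_df_mono[OF assms, of x x y' y]
    by linarith
  ultimately show ?thesis by linarith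
qed

lemma bivariate_df_isCont:
  assumes "bivariate_df F" "isCont (marginal1 F) x" "isCont (marginal2 F) y"
  shows "isCont F (x, y)"
proof -
  have "((\<lambda>p. marginal1 F (fst p)) \<longlongrightarrow> marginal1 F x) (at (x, y))"
    "((\<lambda>p. marginal2 F (snd p)) \<longlongrightarrow> marginal2 F y) (at (x, y))"
    by (rule isCont_tendsto_compose[OF assms(2)] isCont_tendsto_compose[OF assms(3)],
        auto intro!: tendsto_eq_intros)+
  then have "((\<lambda>p. \<bar>marginal1 F (fst p) - marginal1 F x\<bar> + \<bar>marginal2 F (snd p) - marginal2 F y\<bar>)
      \<longlongrightarrow> 0) (at (x, y))"
    by (auto intro!: tendsto_eq_intros)
  then have "((\<lambda>p. F p - F (x, y)) \<longlongrightarrow> 0) (at (x, y))"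
    by (rule Lim_null_comparison[rotated])
       (use bivariate_df_Lipschitz[OF assms(1)] in \<open>auto intro!: always_eventually\<close>)
  then show ?thesis unfolding isCont_def by (rule LIM_zero_cancel)
qed

lemma marginal_mono:
  assumes "bivariate_df F"
  shows "mono (marginal1 F)" "mono (marginal2 F)"
proof -
  have *: "mono (marginal1 G)" if "bivariate_df G" for G
  proof (rule monoI)
    fix x x' :: real assume "x \<le> x'"
    then show "marginal1 G x \<le> marginal1 G x'"
      using bivariate_df_marginal_increment[OF that, of x x' 0] bivariate_df_mono[OF that, of x x' 0 0]
      by simp
  qed
  show "mono (marginal1 F)" by (rule *[OF assms])
  show "mono (marginal2 F)" using *[OF bivariate_df_swap[OF assms]] by simp
qed

lemma bivariate_df_le_1:
  assumes "bivariate_df F"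
  shows "F (x, y) \<le> 1"
  by (rule tendsto_lowerbound[OF bivariate_df_diagonal_tendsto[OF assms]])
     (auto simp: eventually_at_top_linorder intro!: exI[of _ "max x y"] bivariate_df_mono[OF assms])

lemma marginal_bounds:
  assumes "bivariate_df F"
  shows "0 \<le> marginal1 F x" "marginal1 F x \<le> 1" "0 \<le> marginal2 F y" "marginal2 F y \<le> 1"
proof -
  have *: "0 \<le> marginal1 G x \<and> marginal1 G x \<le> 1" if "bivariate_df G" for G x
    using bivariate_df_le_marginal(1)[OF that, of x 0] bivariate_df_nonneg[OF that, of "(x, 0)"]
      tendsto_upperbound[OF bivariate_df_tendsto_marginal1[OF that, of x],
        OF always_eventually[OF allI[OF bivariate_df_le_1[OF that]]]]
    by simp
  show "0 \<le> marginal1 F x" "marginal1 F x \<le> 1" using *[OF assms] by auto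
  show "0 \<le> marginal2 F y" "marginal2 F y \<le> 1" using *[OF bivariate_df_swap[OF assms]] by auto
qed

text \<open>
  The probability that both coordinates exceed the given thresholds, in terms of the distribution
  function.
\<close>
definition joint_tail :: "(real \<times> real \<Rightarrow> real) \<Rightarrow> real \<Rightarrow> real \<Rightarrow> real" where
  "joint_tail F x y = 1 - marginal1 F x - marginal2 F y + F (x, y)"

lemma joint_tail_nonneg:
  assumes "bivariate_df F"
  shows "0 \<le> joint_tail F x y"
proof -
  have "((\<lambda>z. F (z, z) - F (z, y) - F (x, z) + F (x, y)) \<longlongrightarrow> joint_tail F x y) at_top"
    unfolding joint_tail_def
    by (auto intro!: tendsto_eq_intros bivariate_df_diagonal_tendsto
          bivariate_df_tendsto_marginal1 bivariate_df_tendsto_marginal2 assms)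
  moreover have "\<forall>\<^sub>F z in at_top. 0 \<le> F (z, z) - F (z, y) - F (x, z) + F (x, y)"
    using eventually_ge_at_top[of "max x y"]
  proof eventually_elim
    case (elim z)
    then show ?case using bivariate_df_rectangle[OF assms, of x z y z] by simp
  qed
  ultimately show ?thesis by (intro tendsto_lowerbound) auto
qed

lemma joint_tail_le:
  assumes "bivariate_df F"
  shows "joint_tail F x y \<le> 1 - marginal1 F x" "joint_tail F x y \<le> 1 - marginal2 F y"
  using bivariate_df_le_marginal[OF assms, of x y] by (auto simp: joint_tail_def)

lemma bivariate_df_ge:
  assumes "bivariate_df F"
  shows "marginal1 F x + marginal2 F y - 1 \<le> F (x, y)"
  using joint_tail_nonneg[OF assms, of x y] by (simp add: joint_tail_def)

lemma joint_tail_antimono: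
  assumes "bivariate_df F" "x \<le> x'" "y \<le> y'"
  shows "joint_tail F x' y' \<le> joint_tail F x y"
  using bivariate_df_marginal_increment[OF assms(1,2), of y]
    bivariate_df_marginal_increment2[OF assms(1,3), of x'] by (simp add: joint_tail_def)

lemma joint_tail_rectangle:
  assumes "bivariate_df F" "x \<le> x'" "y \<le> y'"
  shows "joint_tail F x y' + joint_tail F x' y \<le> joint_tail F x y + joint_tail F x' y'"
  using bivariate_df_rectangle[OF assms] by (simp add: joint_tail_def)

text \<open>
  Moving one threshold changes a joint tail by at most the mass of the strip between the old and the new
  threshold.
\<close>
lemma joint_tail_Lipschitz:
  assumes "bivariate_df F"
  shows "\<bar>joint_tail F x' y' - joint_tail F x y\<bar> \<le>
    \<bar>marginal1 F x' - marginal1 F x\<bar> + \<bar>marginal2 F y' - marginal2 F y\<bar>"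
proof -
  note inc = bivariate_df_marginal_increment[OF assms] bivariate_df_marginal_increment2[OF assms]
  note mono = bivariate_df_mono[OF assms]
  have "\<bar>joint_tail F x' y' - joint_tail F x y'\<bar> \<le> \<bar>marginal1 F x' - marginal1 F x\<bar>"
    using inc(1)[of x x' y'] inc(1)[of x' x y'] mono[of x x' y' y'] mono[of x' x y' y']
    unfolding joint_tail_def by (smt (verit))
  moreover have "\<bar>joint_tail F x y' - joint_tail F x y\<bar> \<le> \<bar>marginal2 F y' - marginal2 F y\<bar>"
    using inc(2)[of y y' x] inc(2)[of y' y x] mono[of x x y y'] mono[of x x y' y]
    unfolding joint_tail_def by (smt (verit))
  ultimately show ?thesis by linarith
qed

text \<open>
  Pointwise limits do not commute with the limit defining a marginal unless no mass escapes; here none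
  does, because the limit \<open>F\<close> has total mass one. Quantitatively,
  \<open>G(x, y) \<le> G\<^sub>1(x) \<le> G(x, y) + 1 - G(y, y)\<close>, and \<open>F(y, y)\<close> is close to one for large \<open>y\<close>.
\<close>
lemma marginal1_limit:
  assumes G: "\<And>n. n \<ge> N \<Longrightarrow> bivariate_df (G n)" and F: "bivariate_df F"
    and lim: "\<And>x y. (\<lambda>n. G n (x, y)) \<longlonglongrightarrow> F (x, y)"
  shows "(\<lambda>n. marginal1 (G n) x) \<longlonglongrightarrow> marginal1 F x"
proof (rule order_tendstoI)
  fix l assume "l < marginal1 F x"
  then obtain y where "l < F (x, y)"
    using order_tendstoD(1)[OF bivariate_df_tendsto_marginal1[OF F], of l x]
    by (auto dest: eventually_happens)
  then have "\<forall>\<^sub>F n in sequentially. l < G n (x, y)"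
    by (intro order_tendstoD(1)[OF lim])
  then show "\<forall>\<^sub>F n in sequentially. l < marginal1 (G n) x"
    using eventually_ge_at_top[of N]
    by eventually_elim (use bivariate_df_le_marginal(1)[OF G] less_le_trans in blast)
next
  fix u assume u: "marginal1 F x < u"
  have "((\<lambda>y. F (x, y) + 1 - F (y, y)) \<longlongrightarrow> marginal1 F x) at_top"
    by (auto intro!: tendsto_eq_intros bivariate_df_tendsto_marginal1[OF F]
        bivariate_df_diagonal_tendsto[OF F])
  from order_tendstoD(2)[OF this u] obtain y where y: "F (x, y) + 1 - F (y, y) < u"
    by (auto dest: eventually_happens)
  have "(\<lambda>n. G n (x, y) + 1 - G n (y, y)) \<longlonglongrightarrow> F (x, y) + 1 - F (y, y)"
    by (intro tendsto_intros lim)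
  from order_tendstoD(2)[OF this y]
  show "\<forall>\<^sub>F n in sequentially. marginal1 (G n) x < u"
    using eventually_ge_at_top[of N]
  proof eventually_elim
    case (elim n)
    then show ?case
      using bivariate_df_ge[OF G, of n x y] bivariate_df_le_marginal(2)[OF G, of n y y] by linarith
  qed
qed

lemma marginal2_limit:
  assumes G: "\<And>n. n \<ge> N \<Longrightarrow> bivariate_df (G n)" and F: "bivariate_df F"
    and lim: "\<And>x y. (\<lambda>n. G n (x, y)) \<longlonglongrightarrow> F (x, y)"
  shows "(\<lambda>n. marginal2 (G n) y) \<longlonglongrightarrow> marginal2 F y"
  using marginal1_limit[of N "\<lambda>n (x, y). G n (y, x)" "\<lambda>(x, y). F (y, x)" y]
    bivariate_df_swap[OF G] bivariate_df_swap[OF F] lim by simp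

section \<open>Freely max-stable marginals\<close>

text \<open>
  The three types in closed form. The inner maxima keep the base of the power inside the domain where the
  power is continuous: for \<open>\<xi> > 0\<close> the base may be raised to \<open>1\<close>, since below \<open>1\<close> the function is
  clipped to zero anyway.
\<close>
lemma freely_max_stableE:
  assumes "freely_max_stable K"
  obtains (gumbel) m \<sigma> where "\<sigma> > 0" "K = (\<lambda>x. max (1 - exp (- ((x - m) / \<sigma>))) 0)"
  | (frechet) \<xi> m \<sigma> where "\<xi> > 0" "\<sigma> > 0"
      "K = (\<lambda>x. 1 - (max (1 + \<xi> * ((x - m) / \<sigma>)) 1) powr (- 1 / \<xi>))"
  | (weibull) \<xi> m \<sigma> where "\<xi> < 0" "\<sigma> > 0"
      "K = (\<lambda>x. max (1 - (max (1 + \<xi> * ((x - m) / \<sigma>)) 0) powr (- 1 / \<xi>)) 0)"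
proof -
  obtain \<xi> m \<sigma> where \<sigma>: "\<sigma> > 0"
    and K: "\<And>x. K x = (if extreme_value_df \<xi> m \<sigma> x = 0 then 0
                    else max (1 + ln (extreme_value_df \<xi> m \<sigma> x)) 0)"
    using assms by (auto simp: freely_max_stable_def)
  consider "\<xi> = 0" | "\<xi> > 0" | "\<xi> < 0" by linarith
  then show ?thesis
  proof cases
    case 1
    have "K = (\<lambda>x. max (1 - exp (- ((x - m) / \<sigma>))) 0)"
      by (rule ext) (simp add: K extreme_value_df_def 1)
    then show ?thesis using gumbel \<sigma> by blast
  next
    case 2
    have "K x = 1 - (max (1 + \<xi> * ((x - m) / \<sigma>)) 1) powr (- 1 / \<xi>)" for x
    proof (cases "1 + \<xi> * ((x - m) / \<sigma>) \<ge> 1")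
      case True
      then have "(1 + \<xi> * ((x - m) / \<sigma>)) powr (- 1 / \<xi>) \<le> (1 + \<xi> * ((x - m) / \<sigma>)) powr 0"
        using 2 by (intro powr_mono) auto
      then show ?thesis
        using 2 True unfolding K extreme_value_df_def by (auto simp: max_def)
    next
      case False
      show ?thesis
      proof (cases "1 + \<xi> * ((x - m) / \<sigma>) > 0")
        case True
        then have "(1 + \<xi> * ((x - m) / \<sigma>)) powr 0 \<le> (1 + \<xi> * ((x - m) / \<sigma>)) powr (- 1 / \<xi>)"
          using 2 False by (intro powr_mono') auto
        then show ?thesis
          using 2 False True unfolding K extreme_value_df_def by (auto simp: max_def)
      next
        case F2: False
        then show ?thesis
          using 2 False unfolding K extreme_value_df_def by (auto simp: max_def)
      qed
    qed
    then show ?thesis using frechet[OF 2 \<sigma>] by blast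
  next
    case 3
    have "K x = max (1 - (max (1 + \<xi> * ((x - m) / \<sigma>)) 0) powr (- 1 / \<xi>)) 0" for x
      using 3 unfolding K extreme_value_df_def by (simp add: max_def)
    then show ?thesis using weibull[OF 3 \<sigma>] by blast
  qed
qed

lemma freely_max_stable_isCont:
  assumes "freely_max_stable K"
  shows "isCont K x"
  using assms
proof (cases rule: freely_max_stableE)
  case gumbel
  then show ?thesis by (auto intro!: continuous_intros)
next
  case (frechet \<xi> m \<sigma>)
  have "continuous_on UNIV K"
    unfolding frechet(3) by (intro continuous_on_powr continuous_intros) (use frechet in auto)
  then show ?thesis by (simp add: continuous_on_eq_continuous_at)
next
  case (weibull \<xi> m \<sigma>)
  have "continuous_on UNIV K"
    unfolding weibull(3) by (intro continuous_on_powr' continuous_intros)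
      (use weibull in \<open>auto simp: field_simps\<close>)
  then show ?thesis by (simp add: continuous_on_eq_continuous_at)
qed

text \<open>The witnesses invert the explicit formulas; they stand in for quantile functions below.\<close>
lemma freely_max_stable_attains:
  assumes "freely_max_stable K" "0 < t" "t < 1"
  obtains x where "K x = 1 - t"
  using assms(1)
proof (cases rule: freely_max_stableE)
  case (gumbel m \<sigma>)
  have "K (m - \<sigma> * ln t) = 1 - t" using gumbel assms by (simp add: max_def)
  then show ?thesis by (rule that)
next
  case (frechet \<xi> m \<sigma>)
  have "t powr 0 \<le> t powr (- \<xi>)" using frechet assms by (intro powr_mono') auto
  then have "K (m + \<sigma> * ((t powr (- \<xi>) - 1) / \<xi>)) = 1 - t"
    using frechet assms by (simp add: max_def powr_powr)
  then show ?thesis by (rule that)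
next
  case (weibull \<xi> m \<sigma>)
  then have "K (m + \<sigma> * ((t powr (- \<xi>) - 1) / \<xi>)) = 1 - t"
    using weibull assms by (simp add: max_def powr_powr)
  then show ?thesis by (rule that)
qed

text \<open>
  If \<open>K = (1 - T)\<^sub>+\<close> then \<open>T\<close> is divided by \<open>r\<close> under a suitable affine map: a translation by \<open>\<sigma> ln r\<close>
  when \<open>\<xi> = 0\<close>, and otherwise the dilation by \<open>r powr \<xi>\<close> about the point where \<open>1 + \<xi> (x - m) / \<sigma>\<close>
  vanishes. Clipping \<open>T\<close> at one beforehand makes no difference, because \<open>r \<ge> 1\<close>.
\<close>
lemma freely_max_stable_rescale:
  fixes r :: real
  assumes "freely_max_stable K" "r \<ge> 1"
  obtains a b where "a > 0" "\<And>x. K x = max (1 - r * (1 - K (a * x + b))) 0"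
proof -
  have clip: "max (1 - r * T) 0 = max (1 - r * (1 - max (1 - T) 0)) 0" for T :: real
  proof (cases "T \<le> 1")
    case False
    then have "r * T \<ge> 1" using assms(2) mult_mono[of 1 r 1 T] by simp
    then show ?thesis using assms(2) False by simp
  qed simp
  show ?thesis using assms(1)
  proof (cases rule: freely_max_stableE)
    case (gumbel m \<sigma>)
    have eq: "exp (- ((x - m) / \<sigma>)) = r * exp (- ((1 * x + \<sigma> * ln r - m) / \<sigma>))" for x
    proof -
      have "- ((1 * x + \<sigma> * ln r - m) / \<sigma>) = - ((x - m) / \<sigma>) - ln r"
        using gumbel by (simp add: field_simps)
      then show ?thesis using assms(2) by (simp add: exp_diff)
    qed
    have step: "K x = max (1 - r * (1 - K (1 * x + \<sigma> * ln r))) 0" for x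
      by (simp only: gumbel(2) clip[symmetric] eq[of x])
    show ?thesis by (rule that[OF _ step]) simp
  next
    case (frechet \<xi> m \<sigma>)
    define a where "a = r powr \<xi>"
    define b where "b = m - a * m + (a - 1) * \<sigma> / \<xi>"
    have a: "a \<ge> 1" using frechet assms(2) by (simp add: a_def ge_one_powr_ge_zero)
    have arg: "1 + \<xi> * ((a * x + b - m) / \<sigma>) = a * (1 + \<xi> * ((x - m) / \<sigma>))" for x
      using frechet by (simp add: b_def field_simps)
    have a': "a powr (- 1 / \<xi>) = 1 / r"
      using frechet assms(2) by (simp add: a_def powr_powr powr_minus_divide)
    have step: "K x = max (1 - r * (1 - K (a * x + b))) 0" for x
    proof -
      define w where "w = 1 + \<xi> * ((x - m) / \<sigma>)"
      have K: "K x = 1 - max w 1 powr (- 1 / \<xi>)" "K (a * x + b) = 1 - max (a * w) 1 powr (- 1 / \<xi>)"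
        unfolding frechet(3) arg w_def by simp_all
      consider "w \<ge> 1" | "w < 1" "a * w \<ge> 1" | "a * w < 1" "w < 1"
        by linarith
      then show ?thesis
      proof cases
        case 1
        then have "a * w \<ge> 1" using mult_mono[of 1 a 1 w] a by simp
        moreover have "w powr (- 1 / \<xi>) \<le> w powr 0" using 1 frechet by (intro powr_mono) auto
        moreover have "(a * w) powr (- 1 / \<xi>) = w powr (- 1 / \<xi>) / r"
          using 1 a by (simp only: powr_mult a') simp
        ultimately show ?thesis using 1 assms(2) by (simp add: K max_def)
      next
        case 2
        then have w: "w > 0" using a by (smt (verit) mult_nonneg_nonpos)
        then have "w powr 0 \<le> w powr (- 1 / \<xi>)" using 2 frechet by (intro powr_mono') auto
        moreover have "(a * w) powr (- 1 / \<xi>) = w powr (- 1 / \<xi>) / r"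
          using w a by (simp only: powr_mult a') simp
        ultimately show ?thesis using 2 w assms(2) by (simp add: K max_def)
      next
        case 3
        then show ?thesis using assms(2) by (simp add: K max_def)
      qed
    qed
    show ?thesis by (rule that[OF _ step]) (use a in simp)
  next
    case (weibull \<xi> m \<sigma>)
    define a where "a = r powr \<xi>"
    define b where "b = m - a * m + (a - 1) * \<sigma> / \<xi>"
    have a: "a > 0" using assms(2) by (simp add: a_def)
    have arg: "1 + \<xi> * ((a * x + b - m) / \<sigma>) = a * (1 + \<xi> * ((x - m) / \<sigma>))" for x
      using weibull by (simp add: b_def field_simps)
    have a': "a powr (- 1 / \<xi>) = 1 / r"
      using weibull assms(2) by (simp add: a_def powr_powr powr_minus_divide)
    have eq: "max (1 + \<xi> * ((x - m) / \<sigma>)) 0 powr (- 1 / \<xi>) =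
        r * max (1 + \<xi> * ((a * x + b - m) / \<sigma>)) 0 powr (- 1 / \<xi>)" for x
    proof -
      have "max (a * (1 + \<xi> * ((x - m) / \<sigma>))) 0 = a * max (1 + \<xi> * ((x - m) / \<sigma>)) 0"
        using a by (simp add: max_mult_distrib_left)
      then show ?thesis unfolding arg using a assms(2) by (simp only: powr_mult a') simp
    qed
    have step: "K x = max (1 - r * (1 - K (a * x + b))) 0" for x
      by (simp only: weibull(3) clip[symmetric] eq[of x])
    show ?thesis by (rule that[OF a step])
  qed
qed

section \<open>Powers for the bi-free max-convolution\<close>

lemma bifree_max_conv_D:
  assumes "bifree_max_conv F G H"
  shows "bivariate_df F" "bivariate_df G" "bivariate_df H"
    "marginal1 H x = max (marginal1 F x + marginal1 G x - 1) 0"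
    "marginal2 H y = max (marginal2 F y + marginal2 G y - 1) 0"
    "\<lbrakk>F (x, y) > 0; G (x, y) > 0; marginal1 H x > 0; marginal2 H y > 0\<rbrakk> \<Longrightarrow>
       marginal1 H x * marginal2 H y / H (x, y) =
         marginal1 F x * marginal2 F y / F (x, y) + marginal1 G x * marginal2 G y / G (x, y) - 1"
proof -
  note * = assms[unfolded bifree_max_conv_def]
  show "bivariate_df F" "bivariate_df G" "bivariate_df H"
    "marginal1 H x = max (marginal1 F x + marginal1 G x - 1) 0"
    "marginal2 H y = max (marginal2 F y + marginal2 G y - 1) 0"
    using * by blast+
  have "if F (x, y) > 0 \<and> G (x, y) > 0 \<and> marginal1 H x > 0 \<and> marginal2 H y > 0
       then marginal1 H x * marginal2 H y / H (x, y) =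
         marginal1 F x * marginal2 F y / F (x, y) + marginal1 G x * marginal2 G y / G (x, y) - 1
       else H (x, y) = 0"
    using * by blast
  then show "\<lbrakk>F (x, y) > 0; G (x, y) > 0; marginal1 H x > 0; marginal2 H y > 0\<rbrakk> \<Longrightarrow>
       marginal1 H x * marginal2 H y / H (x, y) =
         marginal1 F x * marginal2 F y / F (x, y) + marginal1 G x * marginal2 G y / G (x, y) - 1"
    by (simp only: simp_thms if_True)
qed

lemma bifree_max_power_bivariate_df:
  assumes "bifree_max_power H n K"
  shows "bivariate_df H" "bivariate_df K"
  using assms by (induction rule: bifree_max_power.induct) (auto dest: bifree_max_conv_D)

lemma bifree_max_power_marginal:
  assumes "bifree_max_power H n K"
  shows "marginal1 K x = max (1 - real n * (1 - marginal1 H x)) 0 \<and>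
    marginal2 K y = max (1 - real n * (1 - marginal2 H y)) 0"
  using assms
proof (induction rule: bifree_max_power.induct)
  case one
  then show ?case using marginal_bounds(1,2)[OF one, of x] marginal_bounds(3,4)[OF one, of y] by simp
next
  case (step n K H')
  note bounds = marginal_bounds(1,2)[OF bifree_max_conv_D(2)[OF step(2)], of x]
    marginal_bounds(3,4)[OF bifree_max_conv_D(2)[OF step(2)], of y]
  show ?case
    unfolding bifree_max_conv_D(4,5)[OF step(2)] using step.IH bounds
    by (auto simp: max_def algebra_simps)
qed

text \<open>
  The defining equation of the convolution says that \<open>F\<^sub>1 F\<^sub>2 / F - 1\<close> is additive. The induction has to
  carry the positivity of the power along, because the equation is available only where the previous power
  is positive; positivity follows from \<open>K\<^sub>1 K\<^sub>2 / K \<ge> K\<^sub>1\<close>, which holds as \<open>K \<le> K\<^sub>2\<close>, and likewise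
  for \<open>H\<close>.
\<close>
lemma bifree_max_power_quotient:
  assumes "bifree_max_power H n K" "marginal1 K x > 0" "marginal2 K y > 0" "H (x, y) > 0"
  shows "K (x, y) > 0 \<and> marginal1 K x * marginal2 K y / K (x, y) =
    real n * (marginal1 H x * marginal2 H y / H (x, y)) - (real n - 1)"
  using assms
proof (induction rule: bifree_max_power.induct)
  case one
  then show ?case by simp
next
  case (step n K K')
  note conv = bifree_max_conv_D[OF step.hyps(2)]
  have H1: "marginal1 H x \<le> 1" "marginal2 H y \<le> 1" "0 \<le> marginal1 H x" "0 \<le> marginal2 H y"
    using marginal_bounds[OF conv(2)] by auto
  have K1: "marginal1 K x > 0" "marginal2 K y > 0"
    using step.prems(1,2) H1 unfolding conv(4,5) by auto
  then have IH: "K (x, y) > 0" "marginal1 K x * marginal2 K y / K (x, y) =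
      real n * (marginal1 H x * marginal2 H y / H (x, y)) - (real n - 1)"
    using step by auto
  have eq: "marginal1 K' x * marginal2 K' y / K' (x, y) =
      marginal1 K x * marginal2 K y / K (x, y) + marginal1 H x * marginal2 H y / H (x, y) - 1"
    by (rule conv(6)) (use step IH in auto)
  have quot: "marginal1 G x \<le> marginal1 G x * marginal2 G y / G (x, y)"
    if "bivariate_df G" "G (x, y) > 0" for G
    using mult_left_mono[OF bivariate_df_le_marginal(2)[OF that(1), of x y], of "marginal1 G x"]
      marginal_bounds[OF that(1)] that(2) by (simp add: field_simps)
  have "marginal1 K' x * marginal2 K' y / K' (x, y) > 0"
    unfolding eq
    using quot[OF conv(1) IH(1)] quot[OF conv(2) step.prems(3)] step.prems(1) conv(4)[of x]
    by linarith
  then have "K' (x, y) \<noteq> 0" by auto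
  then have "K' (x, y) > 0" using bivariate_df_nonneg[OF conv(3), of "(x, y)"] by simp
  then show ?case unfolding eq IH(2) by (simp add: algebra_simps add_divide_distrib)
qed

section \<open>Joint exceedances in the domain of attraction\<close>

text \<open>A positive limit means that the clipping at zero is eventually inactive.\<close>
lemma tendsto_of_clipped_limit:
  fixes X Y :: "nat \<Rightarrow> real"
  assumes "X \<longlonglongrightarrow> u" "u > 0" "\<And>n. n \<ge> 1 \<Longrightarrow> X n = max (1 - Y n) 0"
  shows "Y \<longlonglongrightarrow> 1 - u"
proof -
  have "\<forall>\<^sub>F n in sequentially. 1 - X n = Y n"
    using order_tendstoD(1)[OF assms(1,2)] eventually_ge_at_top[of 1]
    by eventually_elim (use assms(3) in \<open>auto simp: max_def split: if_splits\<close>)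
  moreover have "(\<lambda>n. 1 - X n) \<longlonglongrightarrow> 1 - u" by (intro tendsto_intros assms)
  ultimately show ?thesis by (blast intro: Lim_transform_eventually)
qed

lemma tendsto_0_of_real_times:
  fixes X :: "nat \<Rightarrow> real"
  assumes "(\<lambda>n. n * X n) \<longlonglongrightarrow> l"
  shows "X \<longlonglongrightarrow> 0"
proof -
  have "(\<lambda>n. (n * X n) * (1 / real n)) \<longlonglongrightarrow> l * 0"
    by (intro tendsto_mult assms lim_1_over_n)
  moreover have "\<forall>\<^sub>F n in sequentially. (n * X n) * (1 / real n) = X n"
    using eventually_ge_at_top[of 1] by eventually_elim auto
  ultimately show ?thesis by (simp add: tendsto_cong)
qed

text \<open>
  The norming assumptions start at \<open>n = 1\<close> because there is no power with exponent zero. Convergence is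
  assumed at all points: the attracting functions of interest have continuous marginals and are therefore
  continuous.
\<close>
locale bifree_attraction =
  fixes F H :: "real \<times> real \<Rightarrow> real" and K :: "nat \<Rightarrow> real \<times> real \<Rightarrow> real" and a b c d :: "nat \<Rightarrow> real"
  assumes F: "bivariate_df F" and H: "bivariate_df H"
    and power: "\<And>n. n \<ge> 1 \<Longrightarrow> bifree_max_power H n (K n)"
    and pos: "\<And>n. n \<ge> 1 \<Longrightarrow> a n > 0" "\<And>n. n \<ge> 1 \<Longrightarrow> c n > 0"
    and lim: "\<And>x y. (\<lambda>n. K n (a n * x + b n, c n * y + d n)) \<longlonglongrightarrow> F (x, y)"
begin

lemma power_marginal_lim:
  "(\<lambda>n. marginal1 (K n) (a n * x + b n)) \<longlonglongrightarrow> marginal1 F x"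
  "(\<lambda>n. marginal2 (K n) (c n * y + d n)) \<longlonglongrightarrow> marginal2 F y"
proof -
  let ?G = "\<lambda>n (x, y). K n (a n * x + b n, c n * y + d n)"
  have G: "bivariate_df (?G n)" if "n \<ge> 1" for n
    using bivariate_df_affine[OF bifree_max_power_bivariate_df(2)[OF power[OF that]] pos[OF that]] .
  note m = marginal_affine[OF bifree_max_power_bivariate_df(2)[OF power] pos]
  have "(\<lambda>n. marginal1 (?G n) x) \<longlonglongrightarrow> marginal1 F x"
    by (rule marginal1_limit[OF G F]) (use lim in auto)
  moreover have "\<forall>\<^sub>F n in sequentially. marginal1 (?G n) x = marginal1 (K n) (a n * x + b n)"
    using eventually_ge_at_top[of 1] by eventually_elim (rule m(1))
  ultimately show "(\<lambda>n. marginal1 (K n) (a n * x + b n)) \<longlonglongrightarrow> marginal1 F x"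
    by (blast intro: Lim_transform_eventually)
  have "(\<lambda>n. marginal2 (?G n) y) \<longlonglongrightarrow> marginal2 F y"
    by (rule marginal2_limit[OF G F]) (use lim in auto)
  moreover have "\<forall>\<^sub>F n in sequentially. marginal2 (?G n) y = marginal2 (K n) (c n * y + d n)"
    using eventually_ge_at_top[of 1] by eventually_elim (rule m(2))
  ultimately show "(\<lambda>n. marginal2 (K n) (c n * y + d n)) \<longlonglongrightarrow> marginal2 F y"
    by (blast intro: Lim_transform_eventually)
qed

lemma exceedance_lim1:
  assumes "marginal1 F x > 0"
  shows "(\<lambda>n. n * (1 - marginal1 H (a n * x + b n))) \<longlonglongrightarrow> 1 - marginal1 F x"
  by (rule tendsto_of_clipped_limit[OF power_marginal_lim(1) assms])
     (use bifree_max_power_marginal[OF power] in auto)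

lemma exceedance_lim2:
  assumes "marginal2 F y > 0"
  shows "(\<lambda>n. n * (1 - marginal2 H (c n * y + d n))) \<longlonglongrightarrow> 1 - marginal2 F y"
  by (rule tendsto_of_clipped_limit[OF power_marginal_lim(2) assms])
     (use bifree_max_power_marginal[OF power] in auto)

definition \<Phi> :: "real \<Rightarrow> real \<Rightarrow> real" where
  "\<Phi> x y = 1 - marginal1 F x * marginal2 F y / F (x, y)"

text \<open>
  With \<open>P = 1 - H\<^sub>1\<close> and \<open>Q = 1 - H\<^sub>2\<close> at the \<open>n\<close>-th thresholds and \<open>T\<close> the joint tail, one has
  \<open>H\<^sub>1 H\<^sub>2 = H - T + P Q\<close>, so that the quotient for the \<open>n\<close>-th power is \<open>1 - (n T - n P Q) / H\<close>. Here
  \<open>H \<longlonglongrightarrow> 1\<close> and \<open>n P Q \<longlonglongrightarrow> 0\<close>, since \<open>n P\<close> and \<open>n Q\<close> converge. The quotient is thus asymptotically at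
  most one, which gives \<open>F \<ge> F\<^sub>1 F\<^sub>2 > 0\<close> in the limit; only then can the quotient itself be passed to
  the limit.
\<close>
lemma joint_tail_lim:
  assumes "marginal1 F x > 0" "marginal2 F y > 0"
  shows "F (x, y) > 0" "(\<lambda>n. n * joint_tail H (a n * x + b n) (c n * y + d n)) \<longlonglongrightarrow> \<Phi> x y"
proof -
  let ?x = "\<lambda>n. a n * x + b n" and ?y = "\<lambda>n. c n * y + d n"
  define P where "P n = 1 - marginal1 H (?x n)" for n
  define Q where "Q n = 1 - marginal2 H (?y n)" for n
  define h where "h n = H (?x n, ?y n)" for n
  define k where "k n = K n (?x n, ?y n)" for n
  define m where "m n = marginal1 (K n) (?x n) * marginal2 (K n) (?y n)" for n
  define T where "T n = joint_tail H (?x n) (?y n)" for n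
  have nP: "(\<lambda>n. n * P n) \<longlonglongrightarrow> 1 - marginal1 F x" and nQ: "(\<lambda>n. n * Q n) \<longlonglongrightarrow> 1 - marginal2 F y"
    unfolding P_def Q_def by (intro exceedance_lim1 exceedance_lim2 assms)+
  note P = tendsto_0_of_real_times[OF nP] and Q = tendsto_0_of_real_times[OF nQ]
  have nPQ: "(\<lambda>n. n * P n * Q n) \<longlonglongrightarrow> 0" using tendsto_mult[OF nP Q] by simp
  have h: "h \<longlonglongrightarrow> 1"
  proof (rule tendsto_sandwich)
    show "(\<lambda>n. 1 - P n - Q n) \<longlonglongrightarrow> 1" using tendsto_diff[OF tendsto_diff[OF tendsto_const P] Q, of 1] by simp
    show "\<forall>\<^sub>F n in sequentially. 1 - P n - Q n \<le> h n"
    proof (rule always_eventually, rule)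
      fix n show "1 - P n - Q n \<le> h n"
        using bivariate_df_ge[OF H, of "?x n" "?y n"] by (simp add: P_def Q_def h_def)
    qed
    show "\<forall>\<^sub>F n in sequentially. h n \<le> 1" by (simp add: h_def bivariate_df_le_1[OF H])
  qed auto
  have k: "k \<longlonglongrightarrow> F (x, y)" unfolding k_def by (rule lim)
  have m: "m \<longlonglongrightarrow> marginal1 F x * marginal2 F y"
    unfolding m_def by (intro tendsto_mult power_marginal_lim)
  have key: "\<forall>\<^sub>F n in sequentially. h n > 0 \<and> k n > 0 \<and> m n / k n = 1 - (n * T n - n * P n * Q n) / h n"
    using eventually_ge_at_top[of 1] order_tendstoD(1)[OF power_marginal_lim(1) assms(1)]
      order_tendstoD(1)[OF power_marginal_lim(2) assms(2)] order_tendstoD(1)[OF h, of 0, simplified]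
  proof eventually_elim
    case (elim n)
    have eq: "marginal1 H (?x n) * marginal2 H (?y n) = h n - (T n - P n * Q n)"
      by (simp add: P_def Q_def h_def T_def joint_tail_def algebra_simps)
    have "real n * (marginal1 H (?x n) * marginal2 H (?y n) / h n) - (real n - 1) =
        1 - (n * T n - n * P n * Q n) / h n"
      unfolding eq using elim(4) by (simp add: field_simps)
    then show ?case
      using bifree_max_power_quotient[OF power[OF elim(1)] elim(2,3)] elim(4)
      unfolding h_def k_def m_def by auto
  qed
  have "marginal1 F x * marginal2 F y \<le> F (x, y)"
  proof (rule tendsto_le[OF _ _ m])
    have "(\<lambda>n. k n * (1 + n * P n * Q n / h n)) \<longlonglongrightarrow> F (x, y) * (1 + 0 / 1)"
      by (intro tendsto_mult tendsto_add tendsto_divide tendsto_const k nPQ h) auto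
    then show "(\<lambda>n. k n * (1 + n * P n * Q n / h n)) \<longlonglongrightarrow> F (x, y)" by simp
    show "\<forall>\<^sub>F n in sequentially. m n \<le> k n * (1 + n * P n * Q n / h n)"
      using key
    proof eventually_elim
      case (elim n)
      have "0 \<le> n * T n / h n"
        using elim joint_tail_nonneg[OF H] by (simp add: T_def)
      then have "m n / k n \<le> 1 + n * P n * Q n / h n"
        using elim by (simp add: diff_divide_distrib)
      moreover have "k n > 0" using elim by simp
      ultimately show ?case by (simp only: pos_divide_le_eq mult.commute)
    qed
  qed simp
  then show F0: "F (x, y) > 0" using mult_pos_pos[OF assms] by linarith
  have "(\<lambda>n. h n * (1 - m n / k n) + n * P n * Q n)
      \<longlonglongrightarrow> 1 * (1 - marginal1 F x * marginal2 F y / F (x, y)) + 0"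
    by (intro tendsto_intros h m k nPQ) (use F0 in simp)
  moreover have "\<forall>\<^sub>F n in sequentially. h n * (1 - m n / k n) + n * P n * Q n = n * T n"
    using key by eventually_elim auto
  ultimately show "(\<lambda>n. n * joint_tail H (?x n) (?y n)) \<longlonglongrightarrow> \<Phi> x y"
    unfolding \<Phi>_def T_def[symmetric] by (simp add: tendsto_cong)
qed

lemma \<Phi>_bounds:
  assumes "marginal1 F x > 0" "marginal2 F y > 0"
  shows "0 \<le> \<Phi> x y" "\<Phi> x y \<le> 1 - marginal1 F x" "\<Phi> x y \<le> 1 - marginal2 F y"
proof -
  show "0 \<le> \<Phi> x y"
    by (rule tendsto_lowerbound[OF joint_tail_lim(2)[OF assms]])
       (use joint_tail_nonneg[OF H] in auto)
  show "\<Phi> x y \<le> 1 - marginal1 F x"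
    by (rule tendsto_le[OF _ exceedance_lim1[OF assms(1)] joint_tail_lim(2)[OF assms]])
       (auto intro!: always_eventually mult_left_mono joint_tail_le[OF H])
  show "\<Phi> x y \<le> 1 - marginal2 F y"
    by (rule tendsto_le[OF _ exceedance_lim2[OF assms(2)] joint_tail_lim(2)[OF assms]])
       (auto intro!: always_eventually mult_left_mono joint_tail_le[OF H])
qed

lemma \<Phi>_antimono:
  assumes "marginal1 F x > 0" "marginal2 F y > 0" "x \<le> x'" "y \<le> y'"
  shows "\<Phi> x' y' \<le> \<Phi> x y"
proof -
  have pos': "marginal1 F x' > 0" "marginal2 F y' > 0"
    using assms monoD[OF marginal_mono(1)[OF F], of x x'] monoD[OF marginal_mono(2)[OF F], of y y']
    by auto
  show ?thesis
  proof (rule tendsto_le[OF _ joint_tail_lim(2)[OF assms(1,2)] joint_tail_lim(2)[OF pos']])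
    show "\<forall>\<^sub>F n in sequentially. real n * joint_tail H (a n * x' + b n) (c n * y' + d n)
        \<le> real n * joint_tail H (a n * x + b n) (c n * y + d n)"
      using eventually_ge_at_top[of 1]
    proof eventually_elim
      case (elim n)
      then show ?case
        using pos[of n] assms by (intro mult_left_mono joint_tail_antimono[OF H]) auto
    qed
  qed simp
qed

lemma \<Phi>_rectangle:
  assumes "marginal1 F x > 0" "marginal2 F y > 0" "x \<le> x'" "y \<le> y'"
  shows "\<Phi> x y' + \<Phi> x' y \<le> \<Phi> x y + \<Phi> x' y'"
proof -
  have pos': "marginal1 F x' > 0" "marginal2 F y' > 0"
    using assms monoD[OF marginal_mono(1)[OF F], of x x'] monoD[OF marginal_mono(2)[OF F], of y y']
    by auto
  note lims = joint_tail_lim(2)[OF assms(1,2)] joint_tail_lim(2)[OF pos']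
    joint_tail_lim(2)[OF assms(1) pos'(2)] joint_tail_lim(2)[OF pos'(1) assms(2)]
  show ?thesis
  proof (rule tendsto_le[OF _ tendsto_add[OF lims(1,2)] tendsto_add[OF lims(3,4)]])
    show "\<forall>\<^sub>F n in sequentially. real n * joint_tail H (a n * x + b n) (c n * y' + d n) +
           real n * joint_tail H (a n * x' + b n) (c n * y + d n)
        \<le> real n * joint_tail H (a n * x + b n) (c n * y + d n) +
           real n * joint_tail H (a n * x' + b n) (c n * y' + d n)"
      using eventually_ge_at_top[of 1]
    proof eventually_elim
      case (elim n)
      then show ?case
        unfolding distrib_left[symmetric]
        using pos[of n] assms by (intro mult_left_mono joint_tail_rectangle[OF H]) auto
    qed
  qed simp
qed

text \<open>
  Let \<open>m = \<lfloor>n / s\<rfloor>\<close>. For each coordinate, the thresholds of \<open>x'\<close> with index \<open>n\<close> and of \<open>x\<close> with index \<open>m\<close>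
  have exceedance probabilities that, multiplied by \<open>n\<close>, tend to the same limit. Exceedance events of
  the same coordinate are nested, so the two events differ by \<open>o(1 / n)\<close>, and so do the joint tails.
  Multiplied by \<open>n\<close>, the first joint tail tends to \<open>\<Phi> x' y'\<close> and the second to \<open>s * \<Phi> x y\<close>. The case
  \<open>s = 1\<close> says that \<open>\<Phi>\<close> depends on \<open>x\<close> and \<open>y\<close> only through \<open>F\<^sub>1(x)\<close> and \<open>F\<^sub>2(y)\<close>.
\<close>
lemma \<Phi>_homogeneous:
  assumes "marginal1 F x > 0" "marginal2 F y > 0" "0 < s" "s \<le> 1"
    and x': "1 - marginal1 F x' = s * (1 - marginal1 F x)"
    and y': "1 - marginal2 F y' = s * (1 - marginal2 F y)"
  shows "\<Phi> x' y' = s * \<Phi> x y"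
proof -
  have "s * (1 - marginal1 F x) < 1" "s * (1 - marginal2 F y) < 1"
    using mult_mono[of s 1 "1 - marginal1 F x" "1 - marginal1 F x"]
      mult_mono[of s 1 "1 - marginal2 F y" "1 - marginal2 F y"] assms(1-4) marginal_bounds[OF F]
    by (smt (verit))+
  then have pos': "marginal1 F x' > 0" "marginal2 F y' > 0" using x' y' by auto
  define m where "m n = nat \<lfloor>real n / s\<rfloor>" for n
  have m_lim: "filterlim m at_top sequentially"
    unfolding m_def using assms(3)
    by (intro filterlim_compose[OF filterlim_nat_sequentially]
        filterlim_compose[OF filterlim_floor_sequentially]) real_asymp
  have ratio: "(\<lambda>n. real n / real (m n)) \<longlonglongrightarrow> s"
  proof -
    have "(\<lambda>n. real (m n) / real n) \<longlonglongrightarrow> 1 / s"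
    proof (rule tendsto_sandwich)
      show "(\<lambda>n. 1 / s - 1 / real n) \<longlonglongrightarrow> 1 / s"
        using tendsto_diff[OF tendsto_const lim_1_over_n, of "1 / s"] by simp
      have bounds: "n / s - 1 \<le> m n" "m n \<le> n / s" for n
        using assms(3) of_int_floor_le[of "n / s"] real_of_int_floor_gt_diff_one[of "n / s"]
        by (auto simp: m_def)
      show "\<forall>\<^sub>F n in sequentially. 1 / s - 1 / real n \<le> real (m n) / real n"
        using eventually_gt_at_top[of 0]
      proof eventually_elim
        case (elim n)
        then show ?case
          using divide_right_mono[OF bounds(1)[of n], of n] by (simp add: diff_divide_distrib)
      qed
      show "\<forall>\<^sub>F n in sequentially. real (m n) / real n \<le> 1 / s"
        using eventually_gt_at_top[of 0]
      proof eventually_elim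
        case (elim n)
        then show ?case using divide_right_mono[OF bounds(2)[of n], of n] by simp
      qed
    qed simp
    from tendsto_divide[OF tendsto_const this, of 1] show ?thesis using assms(3) by simp
  qed
  have sub: "(\<lambda>n. real n * X (m n)) \<longlonglongrightarrow> s * l" if "(\<lambda>n. real n * X n) \<longlonglongrightarrow> l" for X l
  proof -
    have "(\<lambda>n. real n / real (m n) * (real (m n) * X (m n))) \<longlonglongrightarrow> s * l"
      by (intro tendsto_mult ratio filterlim_compose[OF that m_lim])
    moreover have "\<forall>\<^sub>F n in sequentially.
        real n / real (m n) * (real (m n) * X (m n)) = real n * X (m n)"
      using eventually_compose_filterlim[OF eventually_gt_at_top[of 0] m_lim]
      by eventually_elim auto
    ultimately show ?thesis by (simp add: tendsto_cong)
  qed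
  let ?x = "\<lambda>n. a n * x + b n" and ?y = "\<lambda>n. c n * y + d n"
  let ?x' = "\<lambda>n. a n * x' + b n" and ?y' = "\<lambda>n. c n * y' + d n"
  have D1: "(\<lambda>n. \<bar>n * (1 - marginal1 H (?x' n)) - n * (1 - marginal1 H (?x (m n)))\<bar>) \<longlonglongrightarrow> 0"
    using tendsto_diff[OF exceedance_lim1[OF pos'(1)] sub[OF exceedance_lim1[OF assms(1)]]] x'
    by (intro tendsto_rabs_zero) simp
  have D2: "(\<lambda>n. \<bar>n * (1 - marginal2 H (?y' n)) - n * (1 - marginal2 H (?y (m n)))\<bar>) \<longlonglongrightarrow> 0"
    using tendsto_diff[OF exceedance_lim2[OF pos'(2)] sub[OF exceedance_lim2[OF assms(2)]]] y'
    by (intro tendsto_rabs_zero) simp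
  have "(\<lambda>n. n * joint_tail H (?x' n) (?y' n) - n * joint_tail H (?x (m n)) (?y (m n))) \<longlonglongrightarrow> 0"
  proof (rule Lim_null_comparison[OF always_eventually[OF allI] tendsto_add_zero[OF D1 D2]])
    fix n
    have abs: "\<bar>real n * u - real n * v\<bar> = real n * \<bar>u - v\<bar>" for u v
      by (simp add: abs_mult right_diff_distrib[symmetric])
    show "norm (n * joint_tail H (?x' n) (?y' n) - n * joint_tail H (?x (m n)) (?y (m n)))
      \<le> \<bar>n * (1 - marginal1 H (?x' n)) - n * (1 - marginal1 H (?x (m n)))\<bar> +
        \<bar>n * (1 - marginal2 H (?y' n)) - n * (1 - marginal2 H (?y (m n)))\<bar>"
      unfolding real_norm_def abs distrib_left[symmetric]
      using joint_tail_Lipschitz[OF H, of "?x' n" "?y' n" "?x (m n)" "?y (m n)"]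
      by (intro mult_left_mono) auto
  qed
  moreover have "(\<lambda>n. n * joint_tail H (?x' n) (?y' n) - n * joint_tail H (?x (m n)) (?y (m n)))
      \<longlonglongrightarrow> \<Phi> x' y' - s * \<Phi> x y"
    by (intro tendsto_diff joint_tail_lim(2)[OF pos'] sub[OF joint_tail_lim(2)[OF assms(1,2)]])
  ultimately have "\<Phi> x' y' - s * \<Phi> x y = 0" by (rule LIMSEQ_unique[rotated])
  then show ?thesis by simp
qed

end

section \<open>Tail copulas and their spectral measures\<close>

text \<open>
  The hypothesis says that dilating an interval by \<open>r \<ge> 1\<close> does not increase the slope of the chord above
  it. If \<open>g\<close> fell below one of its chords, consider the minimum of the difference \<open>f\<close>, attained at an
  interior point \<open>w\<close>, and the adjacent intervals from \<open>w / r\<close> to \<open>w\<close> and from \<open>w\<close> to \<open>r * w\<close>. The slope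
  of \<open>f\<close> is at most \<open>0\<close> on the first, at least \<open>0\<close> on the second, and does not increase between them; so
  both slopes vanish. Choosing \<open>r\<close> as large as the chord permits, one of the two outer points is an
  endpoint of the chord, where \<open>f = 0\<close>, in contradiction to \<open>f w < 0\<close>.
\<close>
lemma concave_on_ratio:
  fixes g :: "real \<Rightarrow> real"
  assumes cont: "continuous_on {0<..} g"
    and ratio: "\<And>r u v. 1 \<le> r \<Longrightarrow> 0 < u \<Longrightarrow> u \<le> v \<Longrightarrow> g (r * v) - g (r * u) \<le> r * (g v - g u)"
  shows "concave_on {0<..} g"
proof -
  have chord: "\<alpha> + \<beta> * u \<le> g u"
    if u: "0 < u1" "u1 < u" "u < u2" and ends: "g u1 = \<alpha> + \<beta> * u1" "g u2 = \<alpha> + \<beta> * u2"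
    for u1 u u2 \<alpha> \<beta> :: real
  proof (rule ccontr)
    assume neg: "\<not> \<alpha> + \<beta> * u \<le> g u"
    define f where "f = (\<lambda>u. g u - (\<alpha> + \<beta> * u))"
    have f_ratio: "f (r * v) - f (r * u) \<le> r * (f v - f u)" if "1 \<le> r" "0 < u" "u \<le> v" for r u v
      using ratio[OF that] by (simp add: f_def algebra_simps)
    have "continuous_on {u1..u2} f"
      unfolding f_def by (intro continuous_intros continuous_on_subset[OF cont]) (use u in auto)
    then obtain w where w: "w \<in> {u1..u2}" and min: "\<And>v. v \<in> {u1..u2} \<Longrightarrow> f w \<le> f v"
      using continuous_attains_inf[of "{u1..u2}" f] u by auto
    have "f w < 0" using min[of u] u neg by (auto simp: f_def)
    moreover have "f u1 = 0" "f u2 = 0" using ends by (auto simp: f_def)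
    ultimately have w': "u1 < w" "w < u2" using w by (auto simp: less_le)
    \<comment> \<open>the largest ratio for which \<open>w / r\<close> and \<open>r * w\<close> both stay between \<open>u1\<close> and \<open>u2\<close>\<close>
    define r where "r = min (w / u1) (u2 / w)"
    have r: "r > 1" using w' u by (auto simp: r_def)
    have "r \<le> w / u1" "r \<le> u2 / w" by (auto simp: r_def)
    then have rw: "u1 \<le> w / r" "r * w \<le> u2"
      using r w' u by (auto simp: field_simps)
    have le: "w / r \<le> w" "w \<le> r * w" using r w' u by (auto simp: field_simps)
    have "f (r * w) - f w \<le> r * (f w - f (w / r))"
      using f_ratio[of r "w / r" w] r w' u le by simp
    also have min1: "f w \<le> f (w / r)" using rw le w' by (intro min) auto
    then have "r * (f w - f (w / r)) \<le> 0" using r by (intro mult_nonneg_nonpos) auto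
    finally have "f (r * w) \<le> f w" by simp
    moreover have min2: "f w \<le> f (r * w)" using rw le w' by (intro min) auto
    ultimately have eq1: "f (r * w) = f w" by simp
    with \<open>f (r * w) - f w \<le> r * (f w - f (w / r))\<close> have "0 \<le> r * (f w - f (w / r))" by simp
    then have "f (w / r) \<le> f w" using r by (simp add: zero_le_mult_iff)
    with min1 have eq2: "f (w / r) = f w" by simp
    have "w / r = u1 \<or> r * w = u2"
      using w' u by (auto simp: r_def min_def)
    then show False using eq1 eq2 \<open>f w < 0\<close> \<open>f u1 = 0\<close> \<open>f u2 = 0\<close> by auto
  qed
  show ?thesis
    unfolding concave_on_def
  proof (rule convex_onI)
    fix t u v :: real
    assume t: "0 < t" "t < 1" and uv: "u \<in> {0<..}" "v \<in> {0<..}"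
    have *: "(1 - t) * g u + t * g v \<le> g ((1 - t) * u + t * v)"
      if "0 < t" "t < 1" "0 < u" "u < v" for t u v :: real
    proof -
      define \<beta> where "\<beta> = (g v - g u) / (v - u)"
      have \<beta>: "\<beta> * (v - u) = g v - g u" using that by (simp add: \<beta>_def)
      have "t * (v - u) > 0" "(1 - t) * (v - u) > 0" using that by auto
      then have "u < (1 - t) * u + t * v" "(1 - t) * u + t * v < v"
        by (auto simp: algebra_simps)
      then have "(g u - \<beta> * u) + \<beta> * ((1 - t) * u + t * v) \<le> g ((1 - t) * u + t * v)"
        by (intro chord[of u _ v]) (use that \<beta> in \<open>auto simp: algebra_simps\<close>)
      moreover have "(g u - \<beta> * u) + \<beta> * ((1 - t) * u + t * v) = g u + t * (\<beta> * (v - u))"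
        by (simp add: algebra_simps)
      ultimately show ?thesis unfolding \<beta> by (simp add: algebra_simps)
    qed
    consider "u < v" | "u = v" | "v < u" by linarith
    then have "(1 - t) * g u + t * g v \<le> g ((1 - t) * u + t * v)"
    proof cases
      case 2
      have "(1 - t) * g v + t * g v = g v" "(1 - t) * v + t * v = v" by (auto simp: algebra_simps)
      then show ?thesis by (simp only: 2)
    next
      case 3
      then show ?thesis using *[of "1 - t" v u] t uv by (simp add: algebra_simps)
    qed (use * t uv in auto)
    then show "- g ((1 - t) *\<^sub>R u + t *\<^sub>R v) \<le> (1 - t) * - g u + t * - g v" by simp
  qed simp
qed

text \<open>
  The abstract properties of the limit \<open>\<Phi>\<close> as a function of \<open>(p, q)\<close>, on the closed quadrant. In extreme
  value theory such functions arise as upper tail dependence functions.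
\<close>
locale tail_copula =
  fixes h :: "real \<Rightarrow> real \<Rightarrow> real"
  assumes homogeneous: "\<And>s p q. 0 < s \<Longrightarrow> 0 \<le> p \<Longrightarrow> 0 \<le> q \<Longrightarrow> h (s * p) (s * q) = s * h p q"
    and two_increasing: "\<And>p p' q q'. 0 \<le> p \<Longrightarrow> p \<le> p' \<Longrightarrow> 0 \<le> q \<Longrightarrow> q \<le> q' \<Longrightarrow>
      h p q' + h p' q \<le> h p q + h p' q'"
    and nonneg: "\<And>p q. 0 \<le> p \<Longrightarrow> 0 \<le> q \<Longrightarrow> 0 \<le> h p q"
    and le_left: "\<And>p q. 0 \<le> p \<Longrightarrow> 0 \<le> q \<Longrightarrow> h p q \<le> p"
    and le_right: "\<And>p q. 0 \<le> p \<Longrightarrow> 0 \<le> q \<Longrightarrow> h p q \<le> q"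
begin

lemma zero: "0 \<le> p \<Longrightarrow> h p 0 = 0" "0 \<le> q \<Longrightarrow> h 0 q = 0"
  using nonneg[of p 0] le_right[of p 0] nonneg[of 0 q] le_left[of 0 q] by auto

lemma mono: "\<lbrakk>0 \<le> p; p \<le> p'; 0 \<le> q; q \<le> q'\<rbrakk> \<Longrightarrow> h p q \<le> h p' q'"
  using two_increasing[of p p' 0 q] two_increasing[of 0 p' q q'] by (simp add: zero)

lemma swap: "tail_copula (\<lambda>p q. h q p)"
proof
  fix p p' q q' :: real
  show "\<lbrakk>0 \<le> p; p \<le> p'; 0 \<le> q; q \<le> q'\<rbrakk> \<Longrightarrow> h q' p + h q p' \<le> h q p + h q' p'"
    using two_increasing[of q q' p p'] by simp
qed (auto intro: homogeneous nonneg le_left le_right)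

text \<open>
  For \<open>p < p'\<close>, homogeneity and monotonicity give \<open>h p q \<ge> (p / p') * h p' q\<close>, and \<open>h p' q \<le> p'\<close>.
\<close>
lemma Lipschitz_left:
  assumes "0 \<le> p" "0 \<le> p'" "0 \<le> q"
  shows "\<bar>h p' q - h p q\<bar> \<le> \<bar>p' - p\<bar>"
proof -
  have *: "h p' q - h p q \<le> p' - p" if "0 \<le> p" "p < p'" for p p'
  proof (cases "p = 0")
    case True
    then show ?thesis using le_left[of p' q] that assms by (simp add: zero)
  next
    case False
    have p: "p > 0" using that False by simp
    have "(p / p') * h p' q = h p ((p / p') * q)"
      using homogeneous[of "p / p'" p' q] p that assms by simp
    also have "\<dots> \<le> h p q"
      using p that assms by (intro mono) (auto simp: field_simps mult_right_mono)
    finally have "h p' q - h p q \<le> (1 - p / p') * h p' q" by (simp add: algebra_simps)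
    also have "\<dots> \<le> (1 - p / p') * p'"
      using p that assms by (intro mult_left_mono le_left) auto
    also have "\<dots> = p' - p" using p that by (simp add: field_simps)
    finally show ?thesis .
  qed
  show ?thesis
    using *[of p p'] *[of p' p] mono[of p p' q q] mono[of p' p q q] assms
    by (smt (verit))
qed

lemma Lipschitz:
  assumes "0 \<le> p" "0 \<le> p'" "0 \<le> q" "0 \<le> q'"
  shows "\<bar>h p' q' - h p q\<bar> \<le> \<bar>p' - p\<bar> + \<bar>q' - q\<bar>"
  using Lipschitz_left[of p p' q'] tail_copula.Lipschitz_left[OF swap, of q q' p] assms by linarith

text \<open>
  The slope condition is two-increasingness in disguise: by homogeneity, the increment of \<open>h 1\<close> over a
  dilated interval is \<open>r\<close> times the increment of \<open>h (1 / r)\<close> over the original one.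
\<close>
lemma concave: "concave_on {0<..} (h 1)"
proof (rule concave_on_ratio)
  have "1-lipschitz_on {0<..} (h 1)"
    by (rule lipschitz_onI) (use Lipschitz[of 1 1] in \<open>auto simp: dist_real_def\<close>)
  then show "continuous_on {0<..} (h 1)" by (rule lipschitz_on_continuous_on)
  fix r u v :: real
  assume "1 \<le> r" "0 < u" "u \<le> v"
  then show "h 1 (r * v) - h 1 (r * u) \<le> r * (h 1 v - h 1 u)"
    using homogeneous[of r "1 / r" v] homogeneous[of r "1 / r" u]
      mult_left_mono[OF two_increasing[of "1 / r" 1 u v], of r]
    by (simp add: algebra_simps)
qed

text \<open>
  Concavity of \<open>h 1\<close> carries over to all rays by homogeneity. If one of the coordinates is zero then one of
  the two summands vanishes, and monotonicity suffices.
\<close>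
lemma superadditive:
  assumes "0 \<le> p" "0 \<le> p'" "0 \<le> q" "0 \<le> q'"
  shows "h p q + h p' q' \<le> h (p + p') (q + q')"
proof (cases "p > 0 \<and> p' > 0 \<and> q > 0 \<and> q' > 0")
  case True
  let ?s = "p + p'"
  have scale: "h a b = a * h 1 (b / a)" if "a > 0" "b > 0" for a b
    using homogeneous[of a 1 "b / a"] that by simp
  have complement: "1 - p' / ?s = p / ?s" using True by (simp add: field_simps)
  have "(1 - p' / ?s) * h 1 (q / p) + (p' / ?s) * h 1 (q' / p')
      \<le> h 1 ((1 - p' / ?s) * (q / p) + (p' / ?s) * (q' / p'))"
    using convex_onD[OF concave[unfolded concave_on_def], of "p' / ?s" "q / p" "q' / p'"] True
    by simp
  also have "(1 - p' / ?s) * (q / p) + (p' / ?s) * (q' / p') = (q + q') / ?s"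
    using True by (simp add: complement add_divide_distrib)
  finally have "p / ?s * h 1 (q / p) + (p' / ?s) * h 1 (q' / p') \<le> h 1 ((q + q') / ?s)"
    unfolding complement .
  then have "?s * (p / ?s * h 1 (q / p) + (p' / ?s) * h 1 (q' / p')) \<le> ?s * h 1 ((q + q') / ?s)"
    using True by (intro mult_left_mono) auto
  then show ?thesis
    using True scale[of p q] scale[of p' q'] scale[of ?s "q + q'"] by (simp add: distrib_left)
next
  case False
  then have "h p q = 0 \<or> h p' q' = 0" using assms by (auto simp: zero less_le)
  then show ?thesis
    using mono[of p "p + p'" q "q + q'"] mono[of p' "p + p'" q' "q + q'"] assms by auto
qed

definition A :: "real \<Rightarrow> real" where "A t = 1 - h t (1 - t)"

lemma A_ends: "A 0 = 1" "A 1 = 1" by (simp_all add: A_def zero)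

lemma A_bounds: "t \<in> {0..1} \<Longrightarrow> A t \<le> 1" "t \<in> {0..1} \<Longrightarrow> t \<le> A t" "t \<in> {0..1} \<Longrightarrow> 1 - t \<le> A t"
  using nonneg[of t "1 - t"] le_left[of t "1 - t"] le_right[of t "1 - t"] by (auto simp: A_def)

lemma A_Lipschitz:
  assumes "s \<in> {0..1}" "t \<in> {0..1}"
  shows "\<bar>A s - A t\<bar> \<le> 2 * \<bar>s - t\<bar>"
  using Lipschitz[of s t "1 - s" "1 - t"] assms unfolding A_def atLeastAtMost_iff
  by (smt (verit))

lemma A_midpoint:
  assumes "0 \<le> t - d" "t + d \<le> 1" "0 \<le> d"
  shows "2 * A t \<le> A (t - d) + A (t + d)"
  using superadditive[of "t - d" "t + d" "1 - (t - d)" "1 - (t + d)"] assms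
    homogeneous[of 2 t "1 - t"] by (simp add: A_def algebra_simps)

text \<open>
  The representing measure is found on the segment \<open>x + y = 1\<close>, parametrised by \<open>w = y\<close>. If \<open>\<rho>\<close>
  represents \<open>A\<close>, then formally \<open>\<rho>\<close> of \<open>[0, t]\<close> is \<open>1 + A'(t)\<close>; so \<open>\<rho>\<close> is the second derivative of \<open>A\<close>
  together with an atom \<open>1 + A'(0)\<close> at zero and an atom \<open>1 - A'(1)\<close> at one. The weights below are the
  corresponding difference quotients on the grid of mesh \<open>1 / N\<close>.
\<close>
definition weight :: "nat \<Rightarrow> nat \<Rightarrow> real" where
  "weight N k =
     (if k = 0 then 1 + N * (A (1 / N) - A 0)
      else if k = N then 1 - N * (A 1 - A ((N - 1) / N))
      else N * (A ((k + 1) / N) - 2 * A (k / N) + A ((k - 1) / N)))"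

lemma weight_nonneg:
  assumes "N > 0" "k \<le> N"
  shows "0 \<le> weight N k"
proof -
  consider "k = 0" | "0 < k" "k = N" | "0 < k" "k < N" using assms by linarith
  then show ?thesis
  proof cases
    case 1
    then show ?thesis
      using A_bounds(3)[of "1 / N"] assms by (simp add: weight_def A_ends field_simps)
  next
    case 2
    then show ?thesis
      using A_bounds(2)[of "(N - 1) / N"] assms by (simp add: weight_def A_ends field_simps)
  next
    case 3
    have "0 \<le> real k / N - 1 / N" "real k / N + 1 / N \<le> 1"
      using 3 by (auto simp: field_simps)
    from A_midpoint[OF this]
    have "2 * A (k / N) \<le> A ((k - 1) / N) + A ((k + 1) / N)"
      using 3 by (simp add: diff_divide_distrib add_divide_distrib of_nat_diff add.commute)
    then show ?thesis using 3 by (simp add: weight_def add.commute)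
  qed
qed

lemma sum_weight_lessThan:
  assumes "0 < i" "i \<le> N"
  shows "(\<Sum>k<i. weight N k) = 1 + N * (A (i / N) - A ((i - 1) / N))"
  using assms
proof (induction i rule: nat_induct_non_zero)
  case 1
  then show ?case by (simp add: weight_def)
next
  case (Suc i)
  then show ?case by (simp add: weight_def algebra_simps)
qed

lemma sum_weight:
  assumes "N > 0"
  shows "(\<Sum>k\<le>N. weight N k) = 2"
  using sum_weight_lessThan[of N N] assms
  by (simp add: lessThan_Suc_atMost[symmetric] weight_def of_nat_diff)

lemma sum_weight_linear:
  fixes j N :: nat
  assumes "j \<le> N" "N > 0"
  shows "(\<Sum>k<j. weight N k * (real j - real k)) = j + N * (A (j / N) - 1)"
  using assms(1)
proof (induction j)
  case 0
  then show ?case by (simp add: A_ends)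
next
  case (Suc j)
  have "(\<Sum>k<Suc j. weight N k * (real (Suc j) - real k)) =
      (\<Sum>k<Suc j. weight N k * (real j - real k)) + (\<Sum>k<Suc j. weight N k)"
    unfolding sum.distrib[symmetric]
    by (intro sum.cong) (auto simp: algebra_simps of_nat_diff Suc_diff_le)
  also have "(\<Sum>k<Suc j. weight N k) = 1 + N * (A (Suc j / N) - A (j / N))"
    using Suc.prems by (subst sum_weight_lessThan) auto
  also have "(\<Sum>k<Suc j. weight N k * (real j - real k)) = j + N * (A (j / N) - 1)"
    using Suc by simp
  finally show ?case by (simp add: algebra_simps)
qed

text \<open>
  At the grid points the discrete measure reproduces \<open>A\<close> exactly. This uses
  \<open>max (t (1 - w)) ((1 - t) w) = (1 - t) w + (t - w)\<^sub>+\<close>: the first summand integrates to \<open>1 - t\<close>, and the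
  second one is a double sum of second differences.
\<close>
lemma sum_weight_kernel:
  fixes j N :: nat
  assumes "j \<le> N" "N > 0"
  shows "(\<Sum>k\<le>N. weight N k * max (j / N * (1 - k / N)) ((1 - j / N) * (k / N))) = A (j / N)"
proof -
  have full: "(\<Sum>k\<le>N. weight N k * (real N - real k)) = N"
    using sum_weight_linear[of N N] assms by (simp add: A_ends lessThan_Suc_atMost[symmetric])
  have first: "(\<Sum>k\<le>N. weight N k * k) = N"
  proof -
    have "(\<Sum>k\<le>N. weight N k * k) + (\<Sum>k\<le>N. weight N k * (real N - real k)) = (\<Sum>k\<le>N. weight N k * N)"
      unfolding sum.distrib[symmetric]
      by (intro sum.cong) (auto simp: algebra_simps of_nat_diff)
    also have "\<dots> = 2 * N" by (simp add: sum_distrib_right[symmetric] sum_weight assms)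
    finally show ?thesis using full by simp
  qed
  have pt: "max (j / N * (1 - k / N)) ((1 - j / N) * (k / N)) =
     (1 - j / N) * (k / N) + (if k < j then (real j - real k) / real N else 0)" for k :: nat
    using assms by (auto simp: max_def field_simps)
  have "(\<Sum>k\<le>N. weight N k * (if k < j then (real j - real k) / real N else 0)) =
      (\<Sum>k<j. weight N k * ((real j - real k) / real N))"
    using assms by (intro sum.mono_neutral_cong_right) auto
  also have "\<dots> = (\<Sum>k<j. weight N k * (real j - real k)) / N"
    by (auto simp: sum_divide_distrib of_nat_diff intro!: sum.cong)
  finally have 1: "(\<Sum>k\<le>N. weight N k * (if k < j then (real j - real k) / real N else 0)) =
      (j + N * (A (j / N) - 1)) / N" using assms by (simp add: sum_weight_linear)
  have "(\<Sum>k\<le>N. weight N k * ((1 - j / N) * (k / N))) = (1 - j / N) / N * (\<Sum>k\<le>N. weight N k * k)"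
    by (simp add: sum_distrib_left mult_ac)
  also have "\<dots> = 1 - j / N" using assms by (simp add: first)
  finally show ?thesis
    unfolding pt distrib_left sum.distrib 1 using assms by (simp add: field_simps)
qed


text \<open>The weights have total mass two; halving them gives probability measures.\<close>
definition discrete :: "nat \<Rightarrow> real measure" where
  "discrete N = distr (point_measure {..N} (\<lambda>k. ennreal (weight N k / 2))) borel (\<lambda>k. real k / real N)"

lemma discrete_real_distribution:
  assumes "N > 0"
  shows "real_distribution (discrete N)"
proof -
  have "(\<Sum>k\<le>N. ennreal (weight N k / 2)) = ennreal (\<Sum>k\<le>N. weight N k / 2)"
    by (rule sum_ennreal) (use weight_nonneg[OF assms] in auto)
  also have "(\<Sum>k\<le>N. weight N k / 2) = 1"
    using sum_weight[OF assms] by (simp add: sum_divide_distrib[symmetric])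
  finally have "prob_space (point_measure {..N} (\<lambda>k. ennreal (weight N k / 2)))"
    by (intro prob_spaceI) (simp add: space_point_measure emeasure_point_measure_finite)
  then show ?thesis
    unfolding discrete_def real_distribution_def real_distribution_axioms_def
    by (auto intro!: prob_space.prob_space_distr simp: measurable_point_measure_eq1)
qed

lemma integral_discrete:
  fixes f :: "real \<Rightarrow> real"
  assumes "N > 0" "f \<in> borel_measurable borel"
  shows "integral\<^sup>L (discrete N) f = (\<Sum>k\<le>N. weight N k * f (k / N)) / 2"
proof -
  have "integral\<^sup>L (discrete N) f =
      integral\<^sup>L (point_measure {..N} (\<lambda>k. ennreal (weight N k / 2))) (\<lambda>k. f (real k / real N))"
    unfolding discrete_def
    by (rule integral_distr) (use assms in \<open>auto simp: measurable_point_measure_eq1\<close>)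
  also have "\<dots> = (\<Sum>k\<le>N. (weight N k / 2) *\<^sub>R f (k / N))"
    by (rule lebesgue_integral_point_measure_finite) (use weight_nonneg[OF assms(1)] in auto)
  finally show ?thesis by (simp add: sum_divide_distrib)
qed

lemma discrete_tight: "tight (\<lambda>n. discrete (Suc n))"
proof -
  have "measure (discrete (Suc n)) {-1<..1} = 1" for n
  proof -
    interpret real_distribution "discrete (Suc n)" by (rule discrete_real_distribution) simp
    have "measure (discrete (Suc n)) {-1<..1} = integral\<^sup>L (discrete (Suc n)) (indicator {-1<..1})"
      by simp
    also have "\<dots> = (\<Sum>k\<le>Suc n. weight (Suc n) k * indicator {-1<..1} (k / Suc n)) / 2"
      by (subst integral_discrete) auto
    also have "(\<Sum>k\<le>Suc n. weight (Suc n) k * indicator {-1<..1} (k / Suc n)) =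
        (\<Sum>k\<le>Suc n. weight (Suc n) k)"
      by (intro sum.cong) (auto simp: indicator_def field_simps)
    finally show ?thesis using sum_weight[of "Suc n"] by simp
  qed
  then have "\<exists>a b::real. a < b \<and> (\<forall>n. measure (discrete (Suc n)) {a<..b} > 1 - \<epsilon>)" if "\<epsilon> > 0" for \<epsilon>
    using that by (intro exI[of _ "-1::real"] exI[of _ "1::real"]) simp
  then show ?thesis
    unfolding tight_def using discrete_real_distribution by blast
qed

text \<open>
  Clamping makes the integrands bounded and continuous on the whole line, so that weak convergence applies, and
  later maps the limit measure into the unit interval without a discussion of its support.
\<close>
definition clamp :: "real \<Rightarrow> real" where "clamp w = max 0 (min 1 w)"

definition kernel :: "real \<Rightarrow> real \<Rightarrow> real" where
  "kernel t w = max (t * (1 - clamp w)) ((1 - t) * clamp w)"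

lemma clamp_bounds: "0 \<le> clamp w" "clamp w \<le> 1" by (auto simp: clamp_def)

lemma isCont_clamp: "isCont clamp w"
  unfolding clamp_def[abs_def] by (intro continuous_intros)

lemma isCont_kernel: "isCont (kernel t) w"
  unfolding kernel_def[abs_def] by (intro continuous_intros isCont_clamp)

lemma kernel_bounded:
  assumes "t \<in> {0..1}"
  shows "norm (kernel t w) \<le> 1"
proof -
  have "0 \<le> t * (1 - clamp w)" "t * (1 - clamp w) \<le> 1" "(1 - t) * clamp w \<le> 1"
    using mult_mono[of t 1 "1 - clamp w" 1] mult_mono[of "1 - t" 1 "clamp w" 1] assms
      clamp_bounds[of w] by auto
  then show ?thesis unfolding kernel_def real_norm_def by linarith
qed

lemma kernel_Lipschitz: "\<bar>kernel s w - kernel t w\<bar> \<le> \<bar>s - t\<bar>"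
proof -
  have 1: "\<bar>s * (1 - clamp w) - t * (1 - clamp w)\<bar> \<le> \<bar>s - t\<bar>"
    using clamp_bounds[of w] by (auto simp: left_diff_distrib[symmetric] abs_mult mult_left_le)
  have "(1 - s) * clamp w - (1 - t) * clamp w = (t - s) * clamp w" by (simp add: algebra_simps)
  then have 2: "\<bar>(1 - s) * clamp w - (1 - t) * clamp w\<bar> \<le> \<bar>s - t\<bar>"
    using clamp_bounds[of w] by (simp add: abs_mult mult_left_le abs_minus_commute)
  show ?thesis using 1 2 unfolding kernel_def by linarith
qed

text \<open>
  Both sides are Lipschitz in \<open>t\<close> and agree at the grid point \<open>\<lfloor>t N\<rfloor> / N\<close>, which has distance at most
  \<open>1 / N\<close> from \<open>t\<close>.
\<close>
lemma integral_discrete_kernel: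
  assumes "t \<in> {0..1}" "N > 0"
  shows "\<bar>integral\<^sup>L (discrete N) (kernel t) - A t / 2\<bar> \<le> 2 / N"
proof -
  define j where "j = nat \<lfloor>t * N\<rfloor>"
  have tN: "0 \<le> t * N" "t * N \<le> N" using assms by (auto simp: mult_left_le_one_le)
  then have j: "real j \<le> t * N" "t * N < real j + 1" unfolding j_def by linarith+
  have jN: "j \<le> N" using j tN by linarith
  have "t - j / N = (t * N - j) / N" using assms by (simp add: field_simps)
  then have s: "\<bar>t - j / N\<bar> \<le> 1 / N" "j / N \<in> {0..1}"
    using j jN assms by (auto simp: divide_right_mono)
  have meas: "kernel t \<in> borel_measurable borel"
    by (intro borel_measurable_continuous_onI continuous_at_imp_continuous_on ballI isCont_kernel)
  have clamp: "clamp (k / N) = k / N" if "k \<le> N" for k :: nat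
    using that assms by (simp add: clamp_def field_simps)
  have "(\<Sum>k\<le>N. weight N k * kernel (j / N) (k / N)) = A (j / N)"
    unfolding sum_weight_kernel[OF jN assms(2), symmetric]
    by (intro sum.cong) (auto simp: kernel_def clamp)
  then have "\<bar>(\<Sum>k\<le>N. weight N k * kernel t (k / N)) - A (j / N)\<bar> =
      \<bar>\<Sum>k\<le>N. weight N k * (kernel t (k / N) - kernel (j / N) (k / N))\<bar>"
    by (simp add: right_diff_distrib sum_subtractf)
  also have "\<dots> \<le> (\<Sum>k\<le>N. \<bar>weight N k * (kernel t (k / N) - kernel (j / N) (k / N))\<bar>)"
    by (rule sum_abs)
  also have "\<dots> \<le> (\<Sum>k\<le>N. weight N k * \<bar>t - j / N\<bar>)"
    by (intro sum_mono) (use weight_nonneg[OF assms(2)] kernel_Lipschitz in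
        \<open>auto simp: abs_mult intro!: mult_left_mono\<close>)
  also have "\<dots> = 2 * \<bar>t - j / N\<bar>"
    by (simp add: sum_distrib_right[symmetric] sum_weight[OF assms(2)])
  finally have "\<bar>(\<Sum>k\<le>N. weight N k * kernel t (k / N)) - A t\<bar> \<le> 4 * (1 / N)"
    using A_Lipschitz[OF assms(1) s(2)] s(1) by (smt (verit))
  then show ?thesis unfolding integral_discrete[OF assms(2) meas] by linarith
qed

text \<open>
  All the discrete measures live on the unit interval, so Helly's selection theorem provides a weak limit
  \<open>M\<close>. The spectral measure is twice \<open>M\<close>, transported to the segment by \<open>w \<mapsto> (1 - w, w)\<close>. Its two
  moment conditions are the cases \<open>t = 1\<close> and \<open>t = 0\<close> of the representation.
\<close>
theorem pickands_A: "pickands A"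
proof -
  obtain r M where r: "strict_mono r" and M: "real_distribution M"
    and weak: "weak_conv_m ((\<lambda>n. discrete (Suc n)) \<circ> id \<circ> r) M"
    using tight_imp_convergent_subsubsequence[OF discrete_tight, of id]
    by (auto simp: strict_mono_id)
  interpret M: real_distribution M by (rule M)
  have meas_kernel [measurable]: "kernel t \<in> borel_measurable borel" for t
    by (intro borel_measurable_continuous_onI continuous_at_imp_continuous_on ballI isCont_kernel)
  have [measurable]: "clamp \<in> borel_measurable borel"
    by (intro borel_measurable_continuous_onI continuous_at_imp_continuous_on ballI isCont_clamp)
  have kernel: "integral\<^sup>L M (kernel t) = A t / 2" if t: "t \<in> {0..1}" for t
  proof (rule LIMSEQ_unique)
    show "(\<lambda>n. integral\<^sup>L (discrete (Suc (r n))) (kernel t)) \<longlonglongrightarrow> integral\<^sup>L M (kernel t)"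
      using weak_conv_imp_integral_bdd_continuous_conv[OF _ M weak isCont_kernel kernel_bounded[OF t]]
        discrete_real_distribution by (simp add: comp_def)
    have "(\<lambda>n. integral\<^sup>L (discrete (Suc n)) (kernel t) - A t / 2) \<longlonglongrightarrow> 0"
    proof (rule Lim_null_comparison)
      show "\<forall>\<^sub>F n in sequentially. norm (integral\<^sup>L (discrete (Suc n)) (kernel t) - A t / 2)
          \<le> 2 / real (Suc n)"
        using integral_discrete_kernel[OF t, of "Suc n" for n]
        by (intro always_eventually allI) (simp del: of_nat_Suc)
      show "(\<lambda>n. 2 / real (Suc n)) \<longlonglongrightarrow> 0" by real_asymp
    qed
    from LIMSEQ_subseq_LIMSEQ[OF LIM_zero_cancel[OF this] r]
    show "(\<lambda>n. integral\<^sup>L (discrete (Suc (r n))) (kernel t)) \<longlonglongrightarrow> A t / 2"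
      by (simp add: comp_def)
  qed
  define \<phi> where "\<phi> = (\<lambda>w. (1 - clamp w, clamp w))"
  define R where "R = restrict_space (borel :: (real \<times> real) measure) S2"
  define D where "D = density M (\<lambda>_. ennreal 2)"
  define \<rho> where "\<rho> = distr D R \<phi>"
  have \<phi>_meas: "\<phi> \<in> measurable D R"
    unfolding R_def D_def \<phi>_def
    by (rule measurable_restrict_space2)
       (auto simp: S2_def clamp_bounds borel_prod[symmetric])
  have "emeasure D (space D) = 2"
    unfolding D_def using M.emeasure_space_1 by (simp add: emeasure_density nn_integral_cmult)
  then have "finite_measure D" by (intro finite_measureI) simp
  then have fin: "finite_measure \<rho>"
    unfolding \<rho>_def by (rule finite_measure.finite_measure_distr[OF _ \<phi>_meas])
  have int: "integral\<^sup>L \<rho> f = 2 * integral\<^sup>L M (\<lambda>w. f (\<phi> w))"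
    if "f \<in> borel_measurable borel" for f :: "real \<times> real \<Rightarrow> real"
  proof -
    have [measurable]: "f \<in> borel_measurable R"
      unfolding R_def by (rule measurable_restrict_space1[OF that])
    have "(\<lambda>w. f (\<phi> w)) \<in> borel_measurable D"
      by (rule measurable_compose[OF \<phi>_meas]) measurable
    then have [measurable]: "(\<lambda>w. f (\<phi> w)) \<in> borel_measurable M" by (simp add: D_def)
    have "integral\<^sup>L \<rho> f = integral\<^sup>L D (\<lambda>w. f (\<phi> w))"
      unfolding \<rho>_def by (rule integral_distr[OF \<phi>_meas]) measurable
    then show ?thesis
      unfolding D_def using integral_density[of "\<lambda>w. f (\<phi> w)" M "\<lambda>_. 2"] by simp
  qed
  have \<rho>_kernel: "(LINT p|\<rho>. max (t * fst p) ((1 - t) * snd p)) = A t" if "t \<in> {0..1}" for t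
    using kernel[OF that] by (subst int) (auto simp: \<phi>_def kernel_def[abs_def] borel_prod[symmetric])
  have "kernel 1 = (\<lambda>w. 1 - clamp w)" "kernel 0 = clamp"
    using clamp_bounds by (auto simp: kernel_def fun_eq_iff)
  then have ends: "2 * integral\<^sup>L M (\<lambda>w. 1 - clamp w) = 1" "2 * integral\<^sup>L M clamp = 1"
    using kernel[of 1] kernel[of 0] by (simp_all add: A_ends)
  have "(LINT p|\<rho>. fst p) = 1"
    using ends by (subst int) (auto simp: \<phi>_def borel_prod[symmetric])
  moreover have "(LINT p|\<rho>. snd p) = 1"
    using ends by (subst int) (auto simp: \<phi>_def borel_prod[symmetric])
  moreover have "A \<in> {0..1} \<rightarrow> {1 / 2..1}"
  proof
    fix t :: real assume "t \<in> {0..1}"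
    then show "A t \<in> {1 / 2..1}" using A_bounds[of t] by auto
  qed
  ultimately show ?thesis
    unfolding pickands_def using fin \<rho>_kernel
    by (intro conjI exI[of _ \<rho>]) (auto simp: \<rho>_def R_def)
qed

end

section \<open>From the domain of attraction to a dependence function\<close>

context bifree_attraction
begin

context
  fixes X Y :: "real \<Rightarrow> real"
  assumes X: "\<And>t. 0 < t \<Longrightarrow> t < 1 \<Longrightarrow> marginal1 F (X t) = 1 - t"
    and Y: "\<And>t. 0 < t \<Longrightarrow> t < 1 \<Longrightarrow> marginal2 F (Y t) = 1 - t"
begin

text \<open>
  The arguments of \<open>\<Phi>\<close> only reach exceedance probabilities below one. Evaluating \<open>\<Phi>\<close> on the segment
  \<open>p + q = 1\<close> and extending by homogeneity gives a function on the whole quadrant; \<open>\<Phi>_homogeneous\<close>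
  ensures that the extension agrees with \<open>\<Phi>\<close> off the segment.
\<close>
definition h :: "real \<Rightarrow> real \<Rightarrow> real" where
  "h p q = (if p > 0 \<and> q > 0 then (p + q) * \<Phi> (X (p / (p + q))) (Y (q / (p + q))) else 0)"

lemma h_homogeneous: "s > 0 \<Longrightarrow> h (s * p) (s * q) = s * h p q"
  by (simp add: h_def distrib_left[symmetric] zero_less_mult_iff)

lemma \<Phi>_eq_h:
  assumes x: "0 < marginal1 F x" "marginal1 F x < 1" and y: "0 < marginal2 F y" "marginal2 F y < 1"
  shows "\<Phi> x y = h (1 - marginal1 F x) (1 - marginal2 F y)"
proof -
  define p where "p = 1 - marginal1 F x"
  define q where "q = 1 - marginal2 F y"
  have pq: "0 < p" "p < 1" "0 < q" "q < 1" using x y by (auto simp: p_def q_def)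
  let ?x = "X (p / (p + q))" and ?y = "Y (q / (p + q))"
  have XY: "marginal1 F ?x = 1 - p / (p + q)" "marginal2 F ?y = 1 - q / (p + q)"
    using pq by (intro X Y; simp)+
  then have pos': "marginal1 F ?x > 0" "marginal2 F ?y > 0"
    unfolding XY using pq by auto
  have "\<Phi> x y = (p + q) * \<Phi> ?x ?y"
  proof (cases "p + q \<le> 1")
    case True
    show ?thesis
      by (rule \<Phi>_homogeneous[OF pos']) (use pq True XY in \<open>auto simp: p_def[symmetric] q_def[symmetric]\<close>)
  next
    case False
    have "\<Phi> ?x ?y = 1 / (p + q) * \<Phi> x y"
      by (rule \<Phi>_homogeneous[OF x(1) y(1)])
         (use pq False XY in \<open>auto simp: p_def[symmetric] q_def[symmetric]\<close>)
    then show ?thesis using pq by simp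
  qed
  then show ?thesis using pq by (simp add: h_def p_def[symmetric] q_def[symmetric])
qed

lemma h_eq_\<Phi>:
  assumes "0 < p" "p < 1" "0 < q" "q < 1"
  shows "h p q = \<Phi> (X p) (Y q)"
  using \<Phi>_eq_h[of "X p" "Y q"] X[of p] Y[of q] assms by simp

lemma order_X: "\<lbrakk>0 < p; p \<le> p'; p' < 1\<rbrakk> \<Longrightarrow> X p' \<le> X p"
  using X[of p] X[of p'] monoD[OF marginal_mono(1)[OF F], of "X p" "X p'"]
  by (cases "p = p'"; cases "X p' \<le> X p") auto

lemma order_Y: "\<lbrakk>0 < p; p \<le> p'; p' < 1\<rbrakk> \<Longrightarrow> Y p' \<le> Y p"
  using Y[of p] Y[of p'] monoD[OF marginal_mono(2)[OF F], of "Y p" "Y p'"]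
  by (cases "p = p'"; cases "Y p' \<le> Y p") auto

text \<open>By homogeneity, inequalities for \<open>h\<close> need only be checked inside the unit square, where \<open>h\<close> is \<open>\<Phi>\<close>.\<close>
lemma shrink:
  fixes p q :: real
  assumes "0 \<le> p" "0 \<le> q"
  obtains s where "s > 0" "s * p < 1" "s * q < 1"
  using assms by (intro that[of "1 / (p + q + 1)"]) (auto simp: field_simps)

lemma h_bounds:
  assumes "0 \<le> p" "0 \<le> q"
  shows "0 \<le> h p q" "h p q \<le> p" "h p q \<le> q"
proof -
  obtain s where s: "s > 0" "s * p < 1" "s * q < 1" using shrink[OF assms] .
  have "0 \<le> h (s * p) (s * q) \<and> h (s * p) (s * q) \<le> s * p \<and> h (s * p) (s * q) \<le> s * q"
  proof (cases "p > 0 \<and> q > 0")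
    case True
    then have "0 < s * p" "0 < s * q" using s by auto
    then show ?thesis
      using h_eq_\<Phi>[of "s * p" "s * q"] \<Phi>_bounds[of "X (s * p)" "Y (s * q)"] X[of "s * p"] Y[of "s * q"] s
      by simp
  next
    case False
    then show ?thesis using s assms by (auto simp: h_def)
  qed
  then show "0 \<le> h p q" "h p q \<le> p" "h p q \<le> q"
    unfolding h_homogeneous[OF s(1)] using s(1) by (auto simp: zero_le_mult_iff)
qed

lemma h_mono:
  assumes "0 \<le> p" "p \<le> p'" "0 \<le> q" "q \<le> q'"
  shows "h p q \<le> h p' q'"
proof (cases "p > 0 \<and> q > 0")
  case True
  obtain s where s: "s > 0" "s * p' < 1" "s * q' < 1" using shrink[of p' q'] assms by auto
  have le: "s * p \<le> s * p'" "s * q \<le> s * q'" "0 < s * p" "0 < s * q"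
    using True assms s by auto
  then have le1: "s * p < 1" "s * q < 1" "0 < s * p'" "0 < s * q'" using s by linarith+
  have "\<Phi> (X (s * p)) (Y (s * q)) \<le> \<Phi> (X (s * p')) (Y (s * q'))"
    using X[OF le1(3) s(2)] Y[OF le1(4) s(3)] s
    by (intro \<Phi>_antimono order_X order_Y le) auto
  then have "h (s * p) (s * q) \<le> h (s * p') (s * q')"
    using le le1 s by (simp only: h_eq_\<Phi>)
  then show ?thesis using s by (simp add: h_homogeneous)
next
  case False
  then have "h p q = 0" by (auto simp: h_def)
  then show ?thesis using h_bounds(1)[of p' q'] assms by simp
qed

lemma h_two_increasing:
  assumes "0 \<le> p" "p \<le> p'" "0 \<le> q" "q \<le> q'"
  shows "h p q' + h p' q \<le> h p q + h p' q'"
proof (cases "p > 0 \<and> q > 0")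
  case True
  obtain s where s: "s > 0" "s * p' < 1" "s * q' < 1" using shrink[of p' q'] assms by auto
  have le: "s * p \<le> s * p'" "s * q \<le> s * q'" "0 < s * p" "0 < s * q"
    using True assms s by auto
  then have le1: "s * p < 1" "s * q < 1" "0 < s * p'" "0 < s * q'" using s by linarith+
  have "\<Phi> (X (s * p')) (Y (s * q)) + \<Phi> (X (s * p)) (Y (s * q'))
      \<le> \<Phi> (X (s * p')) (Y (s * q')) + \<Phi> (X (s * p)) (Y (s * q))"
    using X[OF le1(3) s(2)] Y[OF le1(4) s(3)] s
    by (intro \<Phi>_rectangle order_X order_Y le) auto
  then have "h (s * p') (s * q) + h (s * p) (s * q') \<le> h (s * p') (s * q') + h (s * p) (s * q)"
    using le le1 s by (simp only: h_eq_\<Phi>)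
  then have "s * (h p' q + h p q') \<le> s * (h p' q' + h p q)"
    using s by (simp add: h_homogeneous distrib_left)
  then show ?thesis using s by simp
next
  case False
  then have "p = 0 \<or> q = 0" using assms by auto
  moreover have "h 0 z = 0" "h z 0 = 0" for z by (auto simp: h_def)
  ultimately show ?thesis
    using h_mono[of p p' q' q'] h_mono[of p' p' q q'] assms by auto
qed

lemma tail_copula_h: "tail_copula h"
  by standard (auto intro: h_homogeneous h_two_increasing h_bounds)

end

lemma extended_tail_copula:
  assumes "\<And>t. 0 < t \<Longrightarrow> t < 1 \<Longrightarrow> \<exists>x. marginal1 F x = 1 - t"
    and "\<And>t. 0 < t \<Longrightarrow> t < 1 \<Longrightarrow> \<exists>y. marginal2 F y = 1 - t"
  obtains h where "tail_copula h"
    "\<And>x y. \<lbrakk>0 < marginal1 F x; marginal1 F x < 1; 0 < marginal2 F y; marginal2 F y < 1\<rbrakk> \<Longrightarrow>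
       \<Phi> x y = h (1 - marginal1 F x) (1 - marginal2 F y)"
proof -
  define X where "X t = (SOME x. marginal1 F x = 1 - t)" for t
  define Y where "Y t = (SOME y. marginal2 F y = 1 - t)" for t
  have X: "marginal1 F (X t) = 1 - t" if "0 < t" "t < 1" for t
    unfolding X_def using assms(1)[OF that] by (rule someI_ex)
  have Y: "marginal2 F (Y t) = 1 - t" if "0 < t" "t < 1" for t
    unfolding Y_def using assms(2)[OF that] by (rule someI_ex)
  show ?thesis
    by (rule that[OF tail_copula_h[OF X Y] \<Phi>_eq_h[OF X Y]])
qed

text \<open>
  Where both marginals lie strictly between \<open>0\<close> and \<open>1\<close>, the denominator in \<open>C\<^sub>A\<close> is \<open>1 - h p q\<close>, hence
  \<open>F\<^sub>1 F\<^sub>2 / F\<close>. At the remaining points the bounds \<open>F\<^sub>1 + F\<^sub>2 - 1 \<le> F \<le> min F\<^sub>1 F\<^sub>2\<close> determine \<open>F\<close>.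
\<close>
lemma has_dependence_function:
  assumes "freely_max_stable (marginal1 F)" "freely_max_stable (marginal2 F)"
  shows "\<exists>A. has_dependence_function F A"
proof -
  obtain h where "tail_copula h" and \<Phi>:
    "\<And>x y. \<lbrakk>0 < marginal1 F x; marginal1 F x < 1; 0 < marginal2 F y; marginal2 F y < 1\<rbrakk> \<Longrightarrow>
       \<Phi> x y = h (1 - marginal1 F x) (1 - marginal2 F y)"
    using extended_tail_copula freely_max_stable_attains[OF assms(1)] freely_max_stable_attains[OF assms(2)]
    by metis
  interpret tail_copula h by fact
  have "F (x, y) = pickands_copula A (marginal1 F x) (marginal2 F y)" for x y
  proof -
    let ?u = "marginal1 F x" and ?v = "marginal2 F y"
    note bounds = marginal_bounds(1,2)[OF F, of x] marginal_bounds(3,4)[OF F, of y]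
      bivariate_df_le_marginal[OF F, of x y] bivariate_df_ge[OF F, of x y]
      bivariate_df_nonneg[OF F, of "(x, y)"]
    show ?thesis
    proof (cases "?u \<in> {0<..<1} \<and> ?v \<in> {0<..<1}")
      case True
      define p where "p = 1 - ?u"
      define q where "q = 1 - ?v"
      have pq: "p > 0" "q > 0" using True by (auto simp: p_def q_def)
      have A: "(p + q) * A (p / (p + q)) = p + q - h p q"
      proof -
        have "1 - p / (p + q) = q / (p + q)" using pq by (simp add: field_simps)
        then show ?thesis
          using homogeneous[of "p + q" "p / (p + q)" "q / (p + q)"] pq
          by (simp add: A_def right_diff_distrib)
      qed
      have "\<Phi> x y = h p q" using True unfolding p_def q_def by (intro \<Phi>) auto
      moreover have "2 - ?u - ?v = p + q" by (simp add: p_def q_def)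
      ultimately have "- 1 + ?u + ?v + (2 - ?u - ?v) * A ((1 - ?u) / (2 - ?u - ?v)) = ?u * ?v / F (x, y)"
        using A by (simp add: p_def[symmetric]) (simp add: \<Phi>_def p_def q_def)
      then show ?thesis
        using True joint_tail_lim(1)[of x y] by (simp add: pickands_copula_def)
    next
      case False
      then show ?thesis using bounds by (auto simp: pickands_copula_def)
    qed
  qed
  then show ?thesis using pickands_A by (auto simp: has_dependence_function_def)
qed

end

section \<open>Dependence functions\<close>

text \<open>
  Bound the maximum below by each of its arguments and use the moment conditions. The moments being nonzero
  also shows that the coordinates are integrable, as a non-integrable function has integral zero by convention.
\<close>
lemma pickands_bounds:
  assumes "pickands A" "t \<in> {0..1}"
  shows "t \<le> A t" "1 - t \<le> A t" "A t \<le> 1"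
proof -
  obtain \<rho> :: "(real \<times> real) measure" where \<rho>: "finite_measure \<rho>"
    "sets \<rho> = sets (restrict_space borel S2)" "(LINT p|\<rho>. fst p) = 1" "(LINT p|\<rho>. snd p) = 1"
    "A t = (LINT p|\<rho>. max (t * fst p) ((1 - t) * snd p))" and "A \<in> {0..1} \<rightarrow> {1/2..1}"
    using assms unfolding pickands_def by blast
  interpret finite_measure \<rho> by fact
  have int: "integrable \<rho> fst" "integrable \<rho> snd"
    using \<rho>(3,4) not_integrable_integral_eq[of \<rho> fst] not_integrable_integral_eq[of \<rho> snd] by auto
  then have int': "integrable \<rho> (\<lambda>p. t * fst p)" "integrable \<rho> (\<lambda>p. (1 - t) * snd p)" by auto
  have "(LINT p|\<rho>. t * fst p) \<le> A t" "(LINT p|\<rho>. (1 - t) * snd p) \<le> A t"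
    unfolding \<rho>(5) using int' by (intro integral_mono integrable_max; simp)+
  then show "t \<le> A t" "1 - t \<le> A t" using \<rho>(3,4) by auto
  show "A t \<le> 1" using \<open>A \<in> {0..1} \<rightarrow> {1/2..1}\<close> assms(2) by auto
qed

lemma pickands_ends:
  assumes "pickands A"
  shows "A 0 = 1" "A 1 = 1"
  using pickands_bounds[OF assms, of 0] pickands_bounds[OF assms, of 1] by auto

text \<open>
  The interior formula persists on the upper edges because \<open>A 0 = A 1 = 1\<close>. At the corner \<open>u = v = 1\<close>
  the argument of \<open>A\<close> is the quotient \<open>0 / 0 = 0\<close>, but there the factor in front of \<open>A\<close> vanishes.
\<close>
lemma pickands_copula_eq:
  assumes "pickands A" "0 < u" "u \<le> 1" "0 < v" "v \<le> 1"
  defines "D \<equiv> - 1 + u + v + (2 - u - v) * A ((1 - u) / (2 - u - v))"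
  shows "D > 0" "pickands_copula A u v = u * v / D"
proof -
  consider "u = 1" | "v = 1" "u < 1" | "u < 1" "v < 1" using assms by linarith
  then have "D > 0 \<and> pickands_copula A u v = u * v / D"
  proof cases
    case 1
    then have "D = 1" using pickands_ends[OF assms(1)] by (simp add: D_def)
    then show ?thesis using 1 by (simp add: pickands_copula_def)
  next
    case 2
    then have "D = 1" using pickands_ends[OF assms(1)] by (simp add: D_def)
    then show ?thesis using 2 by (simp add: pickands_copula_def)
  next
    case 3
    define t where "t = (1 - u) / (2 - u - v)"
    have "t \<in> {0..1}" using 3 by (auto simp: t_def field_simps)
    then have "(2 - u - v) * t \<le> (2 - u - v) * A t"
      using 3 by (intro mult_left_mono pickands_bounds[OF assms(1)]) auto
    moreover have "(2 - u - v) * t = 1 - u" using 3 by (simp add: t_def)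
    ultimately show ?thesis using 3 assms by (auto simp: D_def pickands_copula_def t_def)
  qed
  then show "D > 0" "pickands_copula A u v = u * v / D" by auto
qed

lemma dependence_function_unique:
  assumes "has_dependence_function F A" "has_dependence_function F B"
    and fms: "freely_max_stable (marginal1 F)" "freely_max_stable (marginal2 F)"
    and t: "t \<in> {0..1}"
  shows "A t = B t"
proof -
  have P: "pickands A" "pickands B" using assms by (auto simp: has_dependence_function_def)
  consider "t = 0" | "t = 1" | "0 < t" "t < 1" using t by fastforce
  then show ?thesis
  proof cases
    case 3
    obtain x where x: "marginal1 F x = 1 - t" using freely_max_stable_attains[OF fms(1) 3] .
    obtain y where y: "marginal2 F y = t" using freely_max_stable_attains[OF fms(2), of "1 - t"] 3 by auto
    have "F (x, y) = (1 - t) * t / C t" if "has_dependence_function F C" for C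
      using that 3 x y by (simp add: has_dependence_function_def pickands_copula_def)
    from this[OF assms(1)] this[OF assms(2)] show ?thesis
      using pickands_bounds(1)[OF P(1) t] pickands_bounds(1)[OF P(2) t] 3 by (simp add: field_simps)
  qed (use pickands_ends[OF P(1)] pickands_ends[OF P(2)] in auto)
qed

text \<open>
  The rescaled functions \<open>K n\<close> are shown to be the powers of \<open>F\<close>. In terms of the marginals of \<open>F\<close>, the
  marginal tails of \<open>K n\<close> are \<open>n\<close> times those of \<open>F\<close>; the argument of \<open>A\<close> is a ratio of tails and does
  not change, so \<open>1 - K\<^sub>1 K\<^sub>2 / K\<close> is also multiplied by \<open>n\<close>.
\<close>
lemma dependence_function_bifree_max_stable:
  assumes F: "bivariate_df F"
    and fms: "freely_max_stable (marginal1 F)" "freely_max_stable (marginal2 F)"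
    and A: "has_dependence_function F A"
  shows "bifree_max_stable F"
proof -
  have P: "pickands A" and FA: "\<And>x y. F (x, y) = pickands_copula A (marginal1 F x) (marginal2 F y)"
    using A by (auto simp: has_dependence_function_def)
  have "\<exists>a b. a > 0 \<and> (\<forall>x. marginal1 F x = max (1 - real n * (1 - marginal1 F (a * x + b))) 0)"
    if "n \<ge> 1" for n
    using freely_max_stable_rescale[OF fms(1), of n] that by (metis of_nat_1 of_nat_le_iff)
  then obtain a b where ab: "\<And>n. n \<ge> 1 \<Longrightarrow> a n > 0"
    "\<And>n x. n \<ge> 1 \<Longrightarrow> marginal1 F x = max (1 - real n * (1 - marginal1 F (a n * x + b n))) 0"
    by metis
  have "\<exists>a b. a > 0 \<and> (\<forall>x. marginal2 F x = max (1 - real n * (1 - marginal2 F (a * x + b))) 0)"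
    if "n \<ge> 1" for n
    using freely_max_stable_rescale[OF fms(2), of n] that by (metis of_nat_1 of_nat_le_iff)
  then obtain c d where cd: "\<And>n. n \<ge> 1 \<Longrightarrow> c n > 0"
    "\<And>n x. n \<ge> 1 \<Longrightarrow> marginal2 F x = max (1 - real n * (1 - marginal2 F (c n * x + d n))) 0"
    by metis
  define K where "K n = (\<lambda>(x, y). F ((1 / a n) * x + - (b n / a n), (1 / c n) * y + - (d n / c n)))" for n
  have Kdf: "bivariate_df (K n)" if "n \<ge> 1" for n
    unfolding K_def by (rule bivariate_df_affine[OF F]) (use ab(1)[OF that] cd(1)[OF that] in auto)
  have K1: "marginal1 (K n) x = max (1 - real n * (1 - marginal1 F x)) 0" if "n \<ge> 1" for n x
    unfolding K_def using ab(1)[OF that] cd(1)[OF that]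
    by (subst marginal_affine(1)[OF F], simp, simp, subst ab(2)[OF that]) (simp add: field_simps)
  have K2: "marginal2 (K n) x = max (1 - real n * (1 - marginal2 F x)) 0" if "n \<ge> 1" for n x
    unfolding K_def using ab(1)[OF that] cd(1)[OF that]
    by (subst marginal_affine(2)[OF F], simp, simp, subst cd(2)[OF that]) (simp add: field_simps)
  have KA: "K n (x, y) = pickands_copula A (marginal1 (K n) x) (marginal2 (K n) y)" if "n \<ge> 1" for n x y
  proof -
    have "marginal1 (K n) x = marginal1 F ((1 / a n) * x + - (b n / a n))"
      "marginal2 (K n) y = marginal2 F ((1 / c n) * y + - (d n / c n))"
      unfolding K_def using ab(1)[OF that] cd(1)[OF that] by (intro marginal_affine[OF F]; simp)+
    then show ?thesis unfolding K_def by (simp add: FA)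
  qed
  have quotient: "K n (x, y) > 0 \<and> marginal1 (K n) x * marginal2 (K n) y / K n (x, y) =
      1 - real n * (1 - (- 1 + marginal1 F x + marginal2 F y + (2 - marginal1 F x - marginal2 F y) *
        A ((1 - marginal1 F x) / (2 - marginal1 F x - marginal2 F y))))"
    if n: "n \<ge> 1" and pos: "marginal1 (K n) x > 0" "marginal2 (K n) y > 0" for n x y
  proof -
    let ?u = "marginal1 F x" and ?v = "marginal2 F y"
    let ?u' = "marginal1 (K n) x" and ?v' = "marginal2 (K n) y"
    have u': "?u' = 1 - n * (1 - ?u)" "?v' = 1 - n * (1 - ?v)"
      using pos K1[OF n, of x] K2[OF n, of y] by (auto simp: max_def split: if_splits)
    have s: "2 - ?u' - ?v' = n * (2 - ?u - ?v)" "1 - ?u' = n * (1 - ?u)"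
      by (simp_all add: u' algebra_simps)
    have arg: "(1 - ?u') / (2 - ?u' - ?v') = (1 - ?u) / (2 - ?u - ?v)"
      unfolding s using n by simp
    have "- 1 + ?u' + ?v' + (2 - ?u' - ?v') * A ((1 - ?u') / (2 - ?u' - ?v')) =
       1 - n * (1 - (- 1 + ?u + ?v + (2 - ?u - ?v) * A ((1 - ?u) / (2 - ?u - ?v))))"
      unfolding arg unfolding s(1) unfolding u' by (simp add: algebra_simps)
    then show ?thesis
      using pickands_copula_eq[OF P pos(1) _ pos(2)] marginal_bounds[OF Kdf[OF n]] pos KA[OF n, of x y]
      by auto
  qed
  \<comment> \<open>The affine map chosen for \<open>n = 1\<close> need not be the identity, but \<open>K 1\<close> has the marginals of \<open>F\<close>
      and is determined by them.\<close>
  have F1: "K 1 = F"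
  proof
    fix z
    have m: "marginal1 (K 1) x = marginal1 F x" "marginal2 (K 1) y = marginal2 F y" for x y
      using K1[of 1 x] K2[of 1 y] marginal_bounds[OF F] by auto
    show "K 1 z = F z" using KA[of 1 "fst z" "snd z"] FA[of "fst z" "snd z"] unfolding m by simp
  qed
  have conv: "bifree_max_conv (K n) F (K (Suc n))" if n: "n \<ge> 1" for n
  proof -
    have M1: "marginal1 (K (Suc n)) x = max (marginal1 (K n) x + marginal1 F x - 1) 0" for x
      using marginal_bounds(1,2)[OF F, of x] by (subst (1 2) K1) (use n in \<open>auto simp: max_def algebra_simps\<close>)
    have M2: "marginal2 (K (Suc n)) x = max (marginal2 (K n) x + marginal2 F x - 1) 0" for x
      using marginal_bounds(3,4)[OF F, of x] by (subst (1 2) K2) (use n in \<open>auto simp: max_def algebra_simps\<close>)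
    have zero: "K (Suc n) (x, y) = 0"
      if "\<not> (marginal1 (K (Suc n)) x > 0 \<and> marginal2 (K (Suc n)) y > 0)" for x y
      using that bivariate_df_le_marginal[OF Kdf, of "Suc n" x y] bivariate_df_nonneg[OF Kdf, of "Suc n" "(x, y)"]
      by auto
    have pos: "K n (x, y) > 0 \<and> F (x, y) > 0 \<and> marginal1 (K (Suc n)) x * marginal2 (K (Suc n)) y / K (Suc n) (x, y) =
              marginal1 (K n) x * marginal2 (K n) y / K n (x, y)
              + marginal1 F x * marginal2 F y / F (x, y) - 1"
      if "marginal1 (K (Suc n)) x > 0" "marginal2 (K (Suc n)) y > 0" for x y
    proof -
      have m: "marginal1 (K n) x > 0" "marginal2 (K n) y > 0" "marginal1 (K 1) x > 0" "marginal2 (K 1) y > 0"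
        using that M1[of x] M2[of y] marginal_bounds(1,2)[OF F, of x] marginal_bounds(3,4)[OF F, of y]
          marginal_bounds(1,2)[OF Kdf[OF n], of x] marginal_bounds(3,4)[OF Kdf[OF n], of y]
        unfolding F1 by linarith+
      show ?thesis
        using quotient[OF n m(1,2)] quotient[of 1, OF _ m(3,4)] quotient[OF _ that] unfolding F1
        by (simp add: algebra_simps)
    qed
    have quotient_eq: "if K n (x, y) > 0 \<and> F (x, y) > 0 \<and> marginal1 (K (Suc n)) x > 0 \<and> marginal2 (K (Suc n)) y > 0
       then marginal1 (K (Suc n)) x * marginal2 (K (Suc n)) y / K (Suc n) (x, y) =
              marginal1 (K n) x * marginal2 (K n) y / K n (x, y)
              + marginal1 F x * marginal2 F y / F (x, y) - 1
       else K (Suc n) (x, y) = 0" for x y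
    proof (cases "marginal1 (K (Suc n)) x > 0 \<and> marginal2 (K (Suc n)) y > 0")
      case True
      then show ?thesis using pos[of x y] by (simp only: simp_thms if_True)
    next
      case False
      then show ?thesis using zero[OF False] by (simp only: simp_thms if_False)
    qed
    have KS: "bivariate_df (K (Suc n))" by (rule Kdf) simp
    show ?thesis
      unfolding bifree_max_conv_def by (intro conjI allI quotient_eq Kdf[OF n] F KS M1 M2)
  qed
  have power: "bifree_max_power F n (K n)" if "n \<ge> 1" for n
    using that
  proof (induction n rule: nat_induct_at_least)
    case base
    then show ?case using bifree_max_power.one[OF F] F1 by simp
  next
    case (Suc n)
    then show ?case using bifree_max_power.step conv by blast
  qed
  show ?thesis
    unfolding bifree_max_stable_def
  proof (intro allI impI)
    fix n :: nat assume n: "n \<ge> 1"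
    have "K n (a n * x + b n, c n * y + d n) = F (x, y)" for x y
      using ab(1)[OF n] cd(1)[OF n] by (simp add: K_def add_divide_distrib)
    then show "\<exists>K a b c d. bifree_max_power F n K \<and> a > 0 \<and> c > 0 \<and>
        (\<forall>x1 x2. K (a * x1 + b, c * x2 + d) = F (x1, x2))"
      using power[OF n] ab(1)[OF n] cd(1)[OF n] by blast
  qed
qed

lemma bifree_max_stable_in_domain:
  assumes "bivariate_df F" "bifree_max_stable F"
  shows "F \<in> bifree_max_domain F"
proof -
  obtain K a b c d where *: "\<And>n. n \<ge> 1 \<Longrightarrow> bifree_max_power F n (K n) \<and> a n > 0 \<and> c n > 0 \<and>
        (\<forall>x1 x2. K n (a n * x1 + b n, c n * x2 + d n) = F (x1, x2))"
    using assms(2) unfolding bifree_max_stable_def by metis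
  have "(\<lambda>n. K n (a n * x + b n, c n * y + d n)) \<longlonglongrightarrow> F (x, y)" for x y
    by (rule tendsto_eventually) (use * in \<open>auto simp: eventually_at_top_linorder intro!: exI[of _ 1]\<close>)
  then show ?thesis unfolding bifree_max_domain_def using * assms(1) by blast
qed

lemma bifree_extreme_value_dependence_function:
  assumes F: "bivariate_df F" and fms: "freely_max_stable (marginal1 F)" "freely_max_stable (marginal2 F)"
    and "bifree_extreme_value F"
  shows "\<exists>A. has_dependence_function F A"
proof -
  have cont: "isCont F (x, y)" for x y
    by (intro bivariate_df_isCont F freely_max_stable_isCont fms)
  obtain H where "H \<in> bifree_max_domain F" using assms(4) by (auto simp: bifree_extreme_value_def)
  then obtain K a b c d where "bifree_attraction F H K a b c d"
    unfolding bifree_max_domain_def bifree_attraction_def using F cont by blast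
  then show ?thesis using bifree_attraction.has_dependence_function fms by blast
qed

theorem theorem8p2:
  fixes F :: "real \<times> real \<Rightarrow> real"
  assumes "bivariate_df F"
    and "freely_max_stable (marginal1 F)"
    and "freely_max_stable (marginal2 F)"
  shows "(bifree_max_stable F \<longleftrightarrow> F \<in> bifree_max_domain F) \<and>
         (F \<in> bifree_max_domain F \<longleftrightarrow> bifree_extreme_value F) \<and>
         (bifree_extreme_value F \<longleftrightarrow> (\<exists>A. has_dependence_function F A)) \<and>
         (bifree_max_stable F \<or> F \<in> bifree_max_domain F \<or> bifree_extreme_value F \<or>
            (\<exists>A. has_dependence_function F A) \<longrightarrow>
          (\<exists>A. has_dependence_function F A \<and> (\<forall>B. has_dependence_function F B \<longrightarrow> (\<forall>t\<in>{0..1}. B t = A t))))"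
proof -
  have 12: "bifree_max_stable F \<Longrightarrow> F \<in> bifree_max_domain F"
    by (rule bifree_max_stable_in_domain[OF assms(1)])
  have 23: "F \<in> bifree_max_domain F \<Longrightarrow> bifree_extreme_value F"
    by (auto simp: bifree_extreme_value_def)
  have 34: "bifree_extreme_value F \<Longrightarrow> \<exists>A. has_dependence_function F A"
    by (rule bifree_extreme_value_dependence_function[OF assms])
  have 41: "\<exists>A. has_dependence_function F A \<Longrightarrow> bifree_max_stable F"
    using dependence_function_bifree_max_stable[OF assms] by blast
  have unique: "B t = A t"
    if "has_dependence_function F A" "has_dependence_function F B" "t \<in> {0..1}" for A B t
    using dependence_function_unique[OF that(2,1) assms(2,3) that(3)] .
  show ?thesis using 12 23 34 41 unique by blast
qed

end
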